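(* Let $R$ be a complex rational function of degree $n\geq 2$ not conjugate (by a Möbius transformation) to $z^{n}$ or $z^{-n}$, and let $\Gamma$ be a subgroup of $G(R)$ such that $\gamma_R(\Gamma)\subseteq\Gamma$. Then $S_{\Gamma,R}$ is left amenable if and only if $\gamma_R(\Gamma)=\Gamma$. Moreover, if $\gamma_R(\Gamma)=\Gamma$, then $S_{\Gamma,R}\subseteq C_{\infty}(R)$ and every subsemigroup of $S_{\Gamma,R}$ is amenable.
   Context: For a rational function $R\in\mathbb{C}(z)$ of degree at least two, $G(R)$ is the group of all Möbius transformations $\sigma$ such that $R\circ\sigma=\nu\circ R$ for some Möbius transformation $\nu$; this $\nu=\nu_\sigma$ is unique and $\gamma_R:\sigma\mapsto\nu_\sigma$ is a homomorphism from $G(R)$ to $\mathrm{Aut}(\mathbb{CP}^1)$. For a subgroup $\Gamma$ of $G(R)$ with $\gamma_R(\Gamma)\subseteq\Gamma$, $S_{\Gamma,R}$ is the semigroup generated under composition by $\Gamma$ and $R$. $C(R)$ is the semigroup of all nonconstant rational functions (including those of degree one) commuting with $R$, and $C_\infty(R)=\bigcup_{k\ge1}C(R^{\circ k})$, where $R^{\circ k}$ is the $k$-th iterate. Semigroups and subsemigroups are nonempty. A semigroup $S$ is left amenable if there is a finitely additive probability measure $\mu$ defined on all subsets of $S$ such that $\mu(a^{-1}T)=\mu(T)$ for all $a\in S$, $T\subseteq S$, where $a^{-1}T=\{s\in S: as\in T\}$. Right amenable is defined symmetrically, with $\{s\in S: sa\in T\}$ in place of $a^{-1}T$. $S$ is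 amenable if it is both left and right amenable. *)

theory Defs
  imports "HOL-Computational_Algebra.Computational_Algebra" "HOL-Algebra.Group"
begin

text \<open>The Riemann sphere. Rational functions are treated as self-maps of it, so that their
  composition is composition of functions.\<close>

datatype cp1 = Fin complex | Infty

text \<open>The map induced by \<open>p / q\<close>, for \<open>p\<close> and \<open>q\<close> coprime. With \<open>d = max (degree p) (degree q)\<close> it is
  \<open>[z : w] \<mapsto> [P (z, w) : Q (z, w)]\<close>, where \<open>P\<close> and \<open>Q\<close> are the homogenizations of \<open>p\<close> and \<open>q\<close>
  in degree \<open>d\<close>; at infinity \<open>[1 : 0]\<close> these give the coefficients of index \<open>d\<close>.\<close>

fun rat_map :: "complex poly \<Rightarrow> complex poly \<Rightarrow> cp1 \<Rightarrow> cp1" where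
  "rat_map p q (Fin z) = (if poly q z = 0 then Infty else Fin (poly p z / poly q z))"
| "rat_map p q Infty =
     (let d = max (degree p) (degree q)
      in if coeff q d = 0 then Infty else Fin (coeff p d / coeff q d))"

definition rational_of_degree :: "nat \<Rightarrow> (cp1 \<Rightarrow> cp1) \<Rightarrow> bool" where
  "rational_of_degree d f \<longleftrightarrow>
     (\<exists>p q. coprime p q \<and> max (degree p) (degree q) = d \<and> f = rat_map p q)"

definition nonconst_rational :: "(cp1 \<Rightarrow> cp1) \<Rightarrow> bool" where
  "nonconst_rational f \<longleftrightarrow> (\<exists>d\<ge>1. rational_of_degree d f)"

definition moebius :: "(cp1 \<Rightarrow> cp1) \<Rightarrow> bool" where
  "moebius \<sigma> \<longleftrightarrow> (\<exists>a b c d. a * d - b * c \<noteq> 0 \<and> \<sigma> = rat_map [:b, a:] [:d, c:])"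

definition moebius_conjugate :: "(cp1 \<Rightarrow> cp1) \<Rightarrow> (cp1 \<Rightarrow> cp1) \<Rightarrow> bool" where
  "moebius_conjugate f g \<longleftrightarrow> (\<exists>\<sigma>. moebius \<sigma> \<and> f = \<sigma> \<circ> g \<circ> inv_into UNIV \<sigma>)"

definition pow_map :: "nat \<Rightarrow> cp1 \<Rightarrow> cp1" where
  "pow_map n = rat_map (monom 1 n) 1"

definition neg_pow_map :: "nat \<Rightarrow> cp1 \<Rightarrow> cp1" where
  "neg_pow_map n = rat_map 1 (monom 1 n)"

definition G_group :: "(cp1 \<Rightarrow> cp1) \<Rightarrow> (cp1 \<Rightarrow> cp1) monoid" where
  "G_group R = \<lparr>carrier = {\<sigma>. moebius \<sigma> \<and> (\<exists>\<nu>. moebius \<nu> \<and> R \<circ> \<sigma> = \<nu> \<circ> R)},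
          mult = (\<circ>), one = id\<rparr>"

definition gamma :: "(cp1 \<Rightarrow> cp1) \<Rightarrow> (cp1 \<Rightarrow> cp1) \<Rightarrow> (cp1 \<Rightarrow> cp1)" where
  "gamma R \<sigma> = (THE \<nu>. moebius \<nu> \<and> R \<circ> \<sigma> = \<nu> \<circ> R)"

inductive_set comp_semigroup :: "('a \<Rightarrow> 'a) set \<Rightarrow> ('a \<Rightarrow> 'a) set"
  for A :: "('a \<Rightarrow> 'a) set"
where
  gen: "f \<in> A \<Longrightarrow> f \<in> comp_semigroup A"
| comp: "f \<in> comp_semigroup A \<Longrightarrow> g \<in> comp_semigroup A \<Longrightarrow> f \<circ> g \<in> comp_semigroup A"

definition S_semigroup :: "(cp1 \<Rightarrow> cp1) set \<Rightarrow> (cp1 \<Rightarrow> cp1) \<Rightarrow> (cp1 \<Rightarrow> cp1) set" where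
  "S_semigroup \<Gamma> R = comp_semigroup (\<Gamma> \<union> {R})"

definition C_comm :: "(cp1 \<Rightarrow> cp1) \<Rightarrow> (cp1 \<Rightarrow> cp1) set" where
  "C_comm R = {f. nonconst_rational f \<and> f \<circ> R = R \<circ> f}"

definition C_inf :: "(cp1 \<Rightarrow> cp1) \<Rightarrow> (cp1 \<Rightarrow> cp1) set" where
  "C_inf R = (\<Union>k\<in>{1..}. C_comm (R ^^ k))"

definition subsemigroup :: "('a \<Rightarrow> 'a \<Rightarrow> 'a) \<Rightarrow> 'a set \<Rightarrow> 'a set \<Rightarrow> bool" where
  "subsemigroup f T S \<longleftrightarrow> T \<noteq> {} \<and> T \<subseteq> S \<and> (\<forall>s\<in>T. \<forall>t\<in>T. f s t \<in> T)"

text \<open>Only the values of the set function on subsets of \<open>S\<close> matter.\<close>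

definition fin_add_prob :: "'a set \<Rightarrow> ('a set \<Rightarrow> real) \<Rightarrow> bool" where
  "fin_add_prob S \<mu> \<longleftrightarrow>
     (\<forall>T. T \<subseteq> S \<longrightarrow> 0 \<le> \<mu> T) \<and> \<mu> S = 1 \<and>
     (\<forall>T U. T \<subseteq> S \<longrightarrow> U \<subseteq> S \<longrightarrow> T \<inter> U = {} \<longrightarrow> \<mu> (T \<union> U) = \<mu> T + \<mu> U)"

definition left_amenable :: "('a \<Rightarrow> 'a \<Rightarrow> 'a) \<Rightarrow> 'a set \<Rightarrow> bool" where
  "left_amenable f S \<longleftrightarrow>
     (\<exists>\<mu>. fin_add_prob S \<mu> \<and> (\<forall>a\<in>S. \<forall>T. T \<subseteq> S \<longrightarrow> \<mu> {s \<in> S. f a s \<in> T} = \<mu> T))"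

definition right_amenable :: "('a \<Rightarrow> 'a \<Rightarrow> 'a) \<Rightarrow> 'a set \<Rightarrow> bool" where
  "right_amenable f S \<longleftrightarrow>
     (\<exists>\<mu>. fin_add_prob S \<mu> \<and> (\<forall>a\<in>S. \<forall>T. T \<subseteq> S \<longrightarrow> \<mu> {s \<in> S. f s a \<in> T} = \<mu> T))"

definition amenable :: "('a \<Rightarrow> 'a \<Rightarrow> 'a) \<Rightarrow> 'a set \<Rightarrow> bool" where
  "amenable f S \<longleftrightarrow> left_amenable f S \<and> right_amenable f S"

end

theory Submission
  imports Defs "HOL-Analysis.Function_Topology"
begin

text \<open>
  Write \<open>n\<close> for the degree of \<open>R\<close> and \<open>D\<close> for the finite set of values with fewer than \<open>n\<close> preimages
  together with all their preimages. If \<open>D\<close> has at most two points, we may move it into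
  \<open>{0, \<infinity>}\<close>; then the Wronskian of numerator and denominator has no root besides \<open>0\<close>, which
  forces \<open>R = \<alpha> \<circ> z\<^sup>n\<close> with \<open>\<alpha>\<close> preserving \<open>{0, \<infinity>}\<close>, so \<open>R\<close> is conjugate to
  \<open>z\<^sup>n\<close> or \<open>z\<^sup>-\<^sup>n\<close>. Otherwise \<open>\<gamma>\<^sub>R(\<Gamma>)\<close> acts faithfully on \<open>D\<close> and \<open>\<Gamma>\<close> is finite.

  Every element of the semigroup is uniquely \<open>\<sigma> \<circ> R\<^sup>k\<close> with \<open>\<sigma>\<close> in \<open>\<Gamma>\<close>. If the semigroup is left
  amenable, any two principal right ideals meet; comparing normal forms in the ideals of \<open>R\<close> and
  \<open>\<sigma> \<circ> R\<close> shows that \<open>\<sigma>\<close> lies in the image of \<open>\<gamma>\<^sub>R\<close>. Conversely, if \<open>\<gamma>\<^sub>R\<close> permutes the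
  finite group \<open>\<Gamma>\<close>, some iterate of it is the identity, so an iterate of \<open>R\<close> is central. The
  semigroup is then cancellative and graded by \<open>k\<close> with levels of size at most \<open>|\<Gamma>|\<close>, so in any
  subsemigroup the sets of bounded grade are Foelner sets.
\<close>

section \<open>Amenability of graded cancellative semigroups\<close>

text \<open>Tychonoff's theorem for copies of the unit interval gives a cluster point of the
  sequence \<open>M\<close>. A filter replaces a subsequence because the index type may be
  uncountable; it will be the type of all sets of semigroup elements.\<close>

lemma simultaneous_cluster_point:
  fixes M :: "nat \<Rightarrow> 'b \<Rightarrow> real"
  assumes "\<And>N t. M N t \<in> {0..1}"
  obtains F x where "F \<noteq> bot" "F \<le> sequentially" "\<And>t. ((\<lambda>N. M N t) \<longlongrightarrow> x t) F"
proof -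
  define K :: "('b \<Rightarrow> real) set" where "K = PiE UNIV (\<lambda>_. {0..1})"
  have "compactin (product_topology (\<lambda>_::'b. euclidean :: real topology) UNIV) K"
    unfolding K_def by (simp add: compactin_PiE)
  then have "compact K"
    by (simp add: euclidean_product_topology)
  moreover have "eventually (\<lambda>y. y \<in> K) (filtermap M sequentially)"
    using assms by (auto simp: eventually_filtermap K_def PiE_def)
  ultimately obtain x where x: "inf (nhds x) (filtermap M sequentially) \<noteq> bot"
    unfolding compact_filter by (metis filtermap_bot_iff sequentially_bot)
  \<comment> \<open>The coarsest filter finer than \<open>sequentially\<close> along which
    \<open>M\<close> tends to \<open>x\<close>; it is proper because \<open>x\<close> is a cluster
    point.\<close>
  define F where "F = inf sequentially (filtercomap M (nhds x))"
  have "F \<noteq> bot"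
  proof
    assume "F = bot"
    then have "eventually (\<lambda>_. False) F" by simp
    then obtain P Q where PQ: "eventually P sequentially" "eventually Q (filtercomap M (nhds x))"
      "\<And>n. P n \<Longrightarrow> Q n \<Longrightarrow> False"
      unfolding F_def eventually_inf by blast
    then obtain Q' where Q': "eventually Q' (nhds x)" "\<And>n. Q' (M n) \<Longrightarrow> Q n"
      unfolding eventually_filtercomap by blast
    have "eventually (\<lambda>y. \<not> Q' y) (filtermap M sequentially)"
      unfolding eventually_filtermap using PQ(1) by eventually_elim (use PQ(3) Q'(2) in blast)
    with Q'(1) have "eventually (\<lambda>_. False) (inf (nhds x) (filtermap M sequentially))"
      unfolding eventually_inf by blast
    with x show False by (simp add: eventually_False)
  qed
  moreover have "F \<le> sequentially" by (simp add: F_def)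
  moreover have "((\<lambda>N. M N t) \<longlongrightarrow> x t) F" for t
  proof -
    have "(M \<longlongrightarrow> x) F"
      by (simp add: F_def filterlim_def filtermap_le_iff_le_filtercomap)
    then show ?thesis
    proof (rule topological_tendstoI[OF eventually_mono[OF topological_tendstoD]])
      fix U :: "real set" assume "open U" "x t \<in> U"
      then show "open ((\<lambda>y. y t) -` U)" "x \<in> (\<lambda>y. y t) -` U"
        using open_vimage[OF _ continuous_on_product_coordinates] by auto
    qed auto
  qed
  ultimately show thesis using that by blast
qed

text \<open>The mean is a limit of the normalized counting measures on \<open>F N\<close>. As
  translation by \<open>a\<close> is injective, the preimage of \<open>U\<close> has as many points
  in \<open>F N\<close> as \<open>U\<close> has in the translate of \<open>F N\<close>, so
  \<open>bnd\<close> is asymptotic invariance.\<close>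

lemma left_amenable_if_Foelner:
  fixes f :: "'a \<Rightarrow> 'a \<Rightarrow> 'a" and F :: "nat \<Rightarrow> 'a set"
  assumes F: "\<And>N. finite (F N)" "\<And>N. F N \<noteq> {}" "\<And>N. F N \<subseteq> T"
    and inj: "\<And>a. a \<in> T \<Longrightarrow> inj_on (f a) T"
    and bnd: "\<And>a U. a \<in> T \<Longrightarrow>
      (\<lambda>N. (real (card (U \<inter> f a ` F N)) - real (card (U \<inter> F N))) / card (F N)) \<longlonglongrightarrow> 0"
  shows "left_amenable f T"
proof -
  define M where "M N U = real (card (U \<inter> F N)) / card (F N)" for N U
  have pos: "real (card (F N)) > 0" for N
    using F by (simp add: card_gt_0_iff)
  have "M N U \<in> {0..1}" for N U
    using pos[of N] by (auto simp: M_def divide_simps intro: card_mono F)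
  then obtain \<F> \<mu> where lim: "\<F> \<noteq> bot" "\<F> \<le> sequentially" "\<And>U. ((\<lambda>N. M N U) \<longlongrightarrow> \<mu> U) \<F>"
    by (rule simultaneous_cluster_point[of M]) blast
  have eqI: "\<mu> U = c" if "\<And>N. M N U = c" for U c
    using lim(3)[of U] lim(1) that by (simp add: tendsto_const_iff)
  have "fin_add_prob T \<mu>"
    unfolding fin_add_prob_def
  proof (intro conjI allI impI)
    show "\<mu> T = 1"
    proof (rule eqI)
      fix N
      have "T \<inter> F N = F N" using F(3) by blast
      then show "M N T = 1" using pos[of N] by (simp add: M_def)
    qed
    show "0 \<le> \<mu> U" for U
      by (rule tendsto_lowerbound[OF lim(3) _ lim(1)]) (simp add: M_def)
    show "\<mu> (U \<union> V) = \<mu> U + \<mu> V" if "U \<inter> V = {}" for U V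
    proof (rule tendsto_unique[OF lim(1) lim(3)])
      have "M N (U \<union> V) = M N U + M N V" for N
      proof -
        have "card ((U \<union> V) \<inter> F N) = card (U \<inter> F N) + card (V \<inter> F N)"
          unfolding Int_Un_distrib2 using that by (intro card_Un_disjoint) (auto simp: F)
        then show ?thesis by (simp add: M_def add_divide_distrib)
      qed
      then show "((\<lambda>N. M N (U \<union> V)) \<longlongrightarrow> \<mu> U + \<mu> V) \<F>"
        using tendsto_add[OF lim(3)[of U] lim(3)[of V]] by simp
    qed
  qed
  moreover have "\<mu> {s \<in> T. f a s \<in> U} = \<mu> U" if "a \<in> T" for a U
  proof -
    let ?V = "{s \<in> T. f a s \<in> U}"
    have "card (?V \<inter> F N) = card (U \<inter> f a ` F N)" for N
    proof -
      have "U \<inter> f a ` F N = f a ` (?V \<inter> F N)" using F(3) by blast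
      moreover have "inj_on (f a) (?V \<inter> F N)"
        using inj[OF that] by (rule inj_on_subset) auto
      ultimately show ?thesis by (simp add: card_image)
    qed
    then have "(\<lambda>N. M N ?V - M N U) \<longlonglongrightarrow> 0"
      using bnd[OF that, of U] by (simp add: M_def diff_divide_distrib)
    then have "((\<lambda>N. M N ?V - M N U) \<longlongrightarrow> 0) \<F>"
      using lim(2) by (rule tendsto_mono[rotated])
    moreover have "((\<lambda>N. M N ?V - M N U) \<longlongrightarrow> \<mu> ?V - \<mu> U) \<F>"
      by (intro tendsto_diff lim)
    ultimately show ?thesis
      using tendsto_unique[OF lim(1)] by fastforce
  qed
  ultimately show ?thesis
    unfolding left_amenable_def by blast
qed

text \<open>The Foelner sets are those of bounded grade: translation by \<open>a\<close> maps grade at most \<open>N\<close> into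
  grade at most \<open>N + g a\<close>, which adds at most \<open>C * g a\<close> elements. If \<open>T\<close> is finite this
  bound does not suffice, but then the sets become stationary.\<close>

lemma graded_left_amenable:
  fixes f :: "'a \<Rightarrow> 'a \<Rightarrow> 'a" and g :: "'a \<Rightarrow> nat"
  assumes "T \<noteq> {}"
    and closed: "\<And>a b. a \<in> T \<Longrightarrow> b \<in> T \<Longrightarrow> f a b \<in> T"
    and grade: "\<And>a b. a \<in> T \<Longrightarrow> b \<in> T \<Longrightarrow> g (f a b) = g a + g b"
    and inj: "\<And>a. a \<in> T \<Longrightarrow> inj_on (f a) T"
    and level: "\<And>k. finite {s \<in> T. g s = k}" "\<And>k. card {s \<in> T. g s = k} \<le> C"
  shows "left_amenable f T"
proof -
  obtain t0 where t0: "t0 \<in> T" using assms(1) by blast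
  \<comment> \<open>Shifting the bound by \<open>g t0\<close> puts \<open>t0\<close> into every set,
    so that none is empty.\<close>
  define F where "F N = {s \<in> T. g s \<le> N + g t0}" for N
  have F_Suc: "F (Suc N) = F N \<union> {s \<in> T. g s = Suc N + g t0}" for N
    by (auto simp: F_def)
  have F_0: "F 0 = (\<Union>k\<le>g t0. {s \<in> T. g s = k})"
    by (auto simp: F_def)
  have fin: "finite (F N)" for N
    by (induction N) (auto simp: F_0 F_Suc level simp del: mem_Collect_eq)
  have ne: "F N \<noteq> {}" and sub: "F N \<subseteq> T" for N
    using t0 by (auto simp: F_def)
  have mono: "F N \<subseteq> F (N + e)" for N e
    by (auto simp: F_def)
  have growth: "card (F (N + e)) \<le> card (F N) + e * C" for N e
  proof (induction e)
    case (Suc e)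
    have "card (F (N + Suc e)) \<le> card (F (N + e)) + card {s \<in> T. g s = Suc (N + e) + g t0}"
      using card_Un_le[of "F (N + e)"] by (simp add: F_Suc)
    also have "\<dots> \<le> card (F N) + e * C + C"
      using Suc level(2) by (intro add_mono) auto
    finally show ?case by simp
  qed simp
  have ratio: "(\<lambda>N. (real (card (F (N + e))) - card (F N)) / card (F N)) \<longlonglongrightarrow> 0" for e
  proof (cases "finite T")
    case True
    define b where "b = Max (g ` T)"
    have "F (N + e) = F N" if "N \<ge> b" for N
    proof -
      have "g s \<le> N" if "s \<in> T" for s
        using Max_ge[of "g ` T" "g s"] True that \<open>N \<ge> b\<close>
        by (simp add: b_def del: Max_ge Max_le_iff)
      then show ?thesis by (force simp: F_def)
    qed
    then have "eventually (\<lambda>N. (real (card (F (N + e))) - card (F N)) / card (F N) = 0) sequentially"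
      unfolding eventually_sequentially by (intro exI[of _ b]) simp
    then show ?thesis by (rule tendsto_eventually)
  next
    case False
    \<comment> \<open>Every finite subset of \<open>T\<close> lies in some \<open>F N\<close>, so
      the sizes are unbounded and the fixed increment \<open>e * C\<close> becomes
      negligible.\<close>
    have "filterlim (\<lambda>N. card (F N)) at_top sequentially"
      unfolding filterlim_at_top
    proof
      fix Z :: nat
      obtain X where X: "X \<subseteq> T" "finite X" "card X = Z"
        using infinite_arbitrarily_large[OF False] by blast
      define b where "b = Max (insert 0 (g ` X))"
      have "X \<subseteq> F N" if "N \<ge> b" for N
      proof
        fix s assume "s \<in> X"
        then have "g s \<le> b" using X(2) by (simp add: b_def)
        then show "s \<in> F N" using X(1) \<open>s \<in> X\<close> that by (auto simp: F_def)
      qed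
      then show "eventually (\<lambda>N. Z \<le> card (F N)) sequentially"
        unfolding eventually_sequentially using X(3) fin card_mono by metis
    qed
    then have "filterlim (\<lambda>N. real (card (F N))) at_top sequentially"
      by (rule filterlim_compose[OF filterlim_real_sequentially])
    then have "(\<lambda>N. real (e * C) / card (F N)) \<longlonglongrightarrow> 0"
      by (rule real_tendsto_divide_at_top[OF tendsto_const])
    then show ?thesis
    proof (rule tendsto_sandwich[OF always_eventually always_eventually tendsto_const, rotated 2])
      show "\<forall>N. 0 \<le> (real (card (F (N + e))) - card (F N)) / card (F N)"
        using card_mono[OF fin mono[of _ e]] by simp
      show "\<forall>N. (real (card (F (N + e))) - card (F N)) / card (F N) \<le> real (e * C) / card (F N)"
      proof
        fix N
        have "real (card (F (N + e))) - card (F N) \<le> real (e * C)"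
          using growth[of N e] by linarith
        then show "(real (card (F (N + e))) - card (F N)) / card (F N) \<le> real (e * C) / card (F N)"
          by (rule divide_right_mono) simp
      qed
    qed
  qed
  show ?thesis
  proof (rule left_amenable_if_Foelner[OF fin ne sub inj])
    fix a U assume a: "a \<in> T"
    define d where "d N = real (card (F (N + g a))) - card (F N)" for N
    have "\<bar>real (card (U \<inter> f a ` F N)) - card (U \<inter> F N)\<bar> \<le> d N" for N
    proof -
      let ?A = "f a ` F N" and ?B = "F (N + g a)"
      have AB: "?A \<subseteq> ?B"
        using a closed grade by (auto simp: F_def)
      have cA: "card ?A = card (F N)"
        using inj[OF a] sub by (meson card_image inj_on_subset)
      \<comment> \<open>Points of \<open>U \<inter> X\<close> outside \<open>Y\<close> lie in
        \<open>?B - Y\<close>. Taking \<open>F N\<close> and its translate in both orders bounds the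
        absolute difference.\<close>
      have "card (U \<inter> X) \<le> card (U \<inter> Y) + (card ?B - card (F N))"
        if "X \<subseteq> ?B" "Y \<subseteq> ?B" "card Y = card (F N)" for X Y
      proof -
        have "card (U \<inter> X) \<le> card ((U \<inter> Y) \<union> (?B - Y))"
          using that fin by (intro card_mono) (auto intro: finite_subset)
        also have "\<dots> \<le> card (U \<inter> Y) + card (?B - Y)" by (rule card_Un_le)
        also have "card (?B - Y) = card ?B - card (F N)"
          using that fin by (simp add: card_Diff_subset finite_subset)
        finally show ?thesis .
      qed
      from this[OF AB mono refl] this[OF mono AB cA]
      show ?thesis
        using card_mono[OF fin mono[of N "g a"]] unfolding d_def by linarith
    qed
    then have "norm ((real (card (U \<inter> f a ` F N)) - real (card (U \<inter> F N))) / card (F N))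
        \<le> norm (d N / card (F N)) * 1" for N
      by (simp add: divide_right_mono abs_le_D1 order_trans[OF _ abs_ge_self])
    moreover have "(\<lambda>N. d N / card (F N)) \<longlonglongrightarrow> 0"
      using ratio[of "g a"] by (simp add: d_def)
    ultimately show "(\<lambda>N. (real (card (U \<inter> f a ` F N)) - real (card (U \<inter> F N))) / card (F N))
        \<longlonglongrightarrow> 0"
      by (blast intro: tendsto_0_le always_eventually)
  qed
qed

text \<open>Right amenability is left amenability of the opposite operation, which has the same
  grading.\<close>

lemma graded_amenable:
  fixes f :: "'a \<Rightarrow> 'a \<Rightarrow> 'a" and g :: "'a \<Rightarrow> nat"
  assumes "T \<noteq> {}"
    and "\<And>a b. a \<in> T \<Longrightarrow> b \<in> T \<Longrightarrow> f a b \<in> T"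
    and "\<And>a b. a \<in> T \<Longrightarrow> b \<in> T \<Longrightarrow> g (f a b) = g a + g b"
    and "\<And>a. a \<in> T \<Longrightarrow> inj_on (f a) T" "\<And>a. a \<in> T \<Longrightarrow> inj_on (\<lambda>s. f s a) T"
    and "\<And>k. finite {s \<in> T. g s = k}" "\<And>k. card {s \<in> T. g s = k} \<le> C"
  shows "amenable f T"
proof -
  have "left_amenable f T"
    using assms by (intro graded_left_amenable[where g = g and C = C]) auto
  moreover have "left_amenable (\<lambda>x y. f y x) T"
    using assms by (intro graded_left_amenable[where g = g and C = C]) (auto simp: add.commute)
  ultimately show ?thesis
    by (simp add: amenable_def left_amenable_def right_amenable_def)
qed

section \<open>Normal forms in the semigroup generated by a group and a map that commutes with it up
  to a twist\<close>

locale skew_semigroup =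
  fixes R :: "'a \<Rightarrow> 'a" and \<Gamma> :: "('a \<Rightarrow> 'a) set" and \<phi> :: "('a \<Rightarrow> 'a) \<Rightarrow> ('a \<Rightarrow> 'a)"
  assumes surj_R: "surj R" and not_inj_R: "\<not> inj R"
    and id_mem: "id \<in> \<Gamma>"
    and comp_mem: "\<sigma> \<in> \<Gamma> \<Longrightarrow> \<tau> \<in> \<Gamma> \<Longrightarrow> \<sigma> \<circ> \<tau> \<in> \<Gamma>"
    and bij_mem: "\<sigma> \<in> \<Gamma> \<Longrightarrow> bij \<sigma>"
    and inv_mem: "\<sigma> \<in> \<Gamma> \<Longrightarrow> inv_into UNIV \<sigma> \<in> \<Gamma>"
    and phi_mem: "\<sigma> \<in> \<Gamma> \<Longrightarrow> \<phi> \<sigma> \<in> \<Gamma>"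
    and R_comp: "\<sigma> \<in> \<Gamma> \<Longrightarrow> R \<circ> \<sigma> = \<phi> \<sigma> \<circ> R"
begin

lemma surj_pow: "surj (R ^^ k)"
  using surj_R by (rule surj_fn)

lemma cancel_pow: "f = g" if "f \<circ> R ^^ k = g \<circ> R ^^ k"
  using that surj_pow[of k] by (metis surj_fun_eq)

lemma phi_comp: "\<phi> (\<sigma> \<circ> \<tau>) = \<phi> \<sigma> \<circ> \<phi> \<tau>" if "\<sigma> \<in> \<Gamma>" "\<tau> \<in> \<Gamma>"
proof -
  have "\<phi> (\<sigma> \<circ> \<tau>) \<circ> R = R \<circ> \<sigma> \<circ> \<tau>"
    by (simp only: R_comp[OF comp_mem[OF that], symmetric] comp_assoc)
  also have "\<dots> = (\<phi> \<sigma> \<circ> \<phi> \<tau>) \<circ> R"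
    by (simp only: R_comp[OF that(1)] R_comp[OF that(2)] comp_assoc)
  finally show ?thesis using cancel_pow[of _ 1] by simp
qed

lemma phi_pow_mem: "\<sigma> \<in> \<Gamma> \<Longrightarrow> (\<phi> ^^ k) \<sigma> \<in> \<Gamma>"
  by (induction k) (auto simp: phi_mem)

lemma pow_comp: "\<sigma> \<in> \<Gamma> \<Longrightarrow> R ^^ k \<circ> \<sigma> = (\<phi> ^^ k) \<sigma> \<circ> R ^^ k"
proof (induction k)
  case (Suc k)
  have "R ^^ Suc k \<circ> \<sigma> = R \<circ> (R ^^ k \<circ> \<sigma>)" by (simp add: comp_assoc)
  also have "\<dots> = (R \<circ> (\<phi> ^^ k) \<sigma>) \<circ> R ^^ k" by (simp only: Suc comp_assoc)
  also have "\<dots> = (\<phi> ^^ Suc k) \<sigma> \<circ> R ^^ Suc k"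
    by (simp only: R_comp[OF phi_pow_mem[OF Suc.prems]] comp_assoc funpow.simps o_apply)
  finally show ?case .
qed simp

text \<open>Multiplication as in a skew product: moving \<open>R ^^ i\<close> to the right past
  \<open>\<tau>\<close> twists \<open>\<tau>\<close> by \<open>\<phi> ^^ i\<close>.\<close>

lemma comp_normal:
  assumes "\<sigma> \<in> \<Gamma>" "\<tau> \<in> \<Gamma>"
  shows "(\<sigma> \<circ> R ^^ i) \<circ> (\<tau> \<circ> R ^^ j) = (\<sigma> \<circ> (\<phi> ^^ i) \<tau>) \<circ> R ^^ (i + j)"
proof -
  have "(\<sigma> \<circ> R ^^ i) \<circ> (\<tau> \<circ> R ^^ j) = \<sigma> \<circ> (R ^^ i \<circ> \<tau>) \<circ> R ^^ j" by (simp add: comp_assoc)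
  also have "\<dots> = (\<sigma> \<circ> (\<phi> ^^ i) \<tau>) \<circ> R ^^ (i + j)"
    by (simp add: pow_comp assms comp_assoc funpow_add)
  finally show ?thesis .
qed

abbreviation S :: "('a \<Rightarrow> 'a) set" where
  "S \<equiv> comp_semigroup (\<Gamma> \<union> {R})"

lemma S_normal_form: "s \<in> S \<Longrightarrow> \<exists>\<sigma>\<in>\<Gamma>. \<exists>k. s = \<sigma> \<circ> R ^^ k"
proof (induction rule: comp_semigroup.induct)
  case (gen f)
  show ?case
  proof (cases "f = R")
    case True
    then have "f = id \<circ> R ^^ 1" by simp
    then show ?thesis using id_mem by blast
  next
    case False
    then have "f \<in> \<Gamma>" "f = f \<circ> R ^^ 0" using gen by auto
    then show ?thesis by blast
  qed
next
  case (comp f g)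
  then show ?case
    using comp_normal comp_mem phi_pow_mem by metis
qed

lemma mem_S:
  assumes "\<sigma> \<in> \<Gamma>" shows "\<sigma> \<circ> R ^^ k \<in> S"
proof (induction k)
  case 0 show ?case using assms by (auto intro: comp_semigroup.gen)
next
  case (Suc k)
  have "R \<in> S" by (auto intro: comp_semigroup.gen)
  with Suc have "(\<sigma> \<circ> R ^^ k) \<circ> R \<in> S" by (rule comp_semigroup.comp)
  then show ?case by (simp only: funpow_Suc_right comp_assoc)
qed

text \<open>If \<open>i < j\<close>, cancelling \<open>R ^^ i\<close> on the right leaves
  \<open>\<sigma>\<close> equal to a composite with innermost factor \<open>R\<close>. Injectivity
  of \<open>\<sigma>\<close> would pass to \<open>R\<close>.\<close>

lemma exponent_unique:
  assumes "\<sigma> \<in> \<Gamma>" "\<tau> \<in> \<Gamma>" "\<sigma> \<circ> R ^^ i = \<tau> \<circ> R ^^ j"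
  shows "i = j"
proof -
  have False if "i < j" "\<sigma> \<in> \<Gamma>" "\<sigma> \<circ> R ^^ i = \<tau> \<circ> R ^^ j" for \<sigma> \<tau> i j
  proof -
    define d where "d = j - i - 1"
    have "R ^^ j = R ^^ Suc d \<circ> R ^^ i"
      using that(1) by (simp only: d_def funpow_add[symmetric]) simp
    then have "\<sigma> \<circ> R ^^ i = (\<tau> \<circ> R ^^ Suc d) \<circ> R ^^ i"
      using that(3) by (simp only: comp_assoc)
    then have "\<sigma> = \<tau> \<circ> R ^^ d \<circ> R"
      by (simp only: cancel_pow funpow_Suc_right comp_assoc)
    then have "inj R"
      using bij_mem[OF that(2)] by (metis bij_is_inj inj_on_imageI2)
    then show False using not_inj_R by simp
  qed
  from this[of i j] this[of j i] show ?thesis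
    using assms by (metis linorder_neqE_nat)
qed

lemma normal_unique:
  assumes "\<sigma> \<in> \<Gamma>" "\<tau> \<in> \<Gamma>" "\<sigma> \<circ> R ^^ i = \<tau> \<circ> R ^^ j"
  shows "\<sigma> = \<tau>"
  using assms exponent_unique[OF assms] cancel_pow by blast

text \<open>The grade of an element of \<open>S\<close>, well defined there by
  \<open>exponent_unique\<close>.\<close>

definition exponent :: "('a \<Rightarrow> 'a) \<Rightarrow> nat" where
  "exponent s = (THE k. \<exists>\<sigma>\<in>\<Gamma>. s = \<sigma> \<circ> R ^^ k)"

lemma exponent_eq: "\<sigma> \<in> \<Gamma> \<Longrightarrow> exponent (\<sigma> \<circ> R ^^ k) = k"
  unfolding exponent_def using exponent_unique by (intro the_equality) blast+

text \<open>In a left amenable semigroup every principal right ideal has measure one, so \<open>R S\<close> and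
  \<open>\<sigma> R S\<close> meet for every \<open>\<sigma>\<close> in \<open>\<Gamma>\<close>.\<close>

lemma phi_onto_if_left_amenable:
  assumes "left_amenable (\<circ>) S"
  shows "\<phi> ` \<Gamma> = \<Gamma>"
proof
  show "\<phi> ` \<Gamma> \<subseteq> \<Gamma>" using phi_mem by blast
  show "\<Gamma> \<subseteq> \<phi> ` \<Gamma>"
  proof
    fix \<sigma> assume \<sigma>: "\<sigma> \<in> \<Gamma>"
    obtain \<mu> where fa: "fin_add_prob S \<mu>"
      and inv: "\<And>a T. a \<in> S \<Longrightarrow> T \<subseteq> S \<Longrightarrow> \<mu> {s \<in> S. a \<circ> s \<in> T} = \<mu> T"
      using assms unfolding left_amenable_def by blast
    have ideal: "(\<circ>) a ` S \<subseteq> S" "\<mu> ((\<circ>) a ` S) = 1" if "a \<in> S" for a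
    proof -
      show sub: "(\<circ>) a ` S \<subseteq> S" using that by (auto intro: comp_semigroup.comp)
      have "{s \<in> S. a \<circ> s \<in> (\<circ>) a ` S} = S" by blast
      then show "\<mu> ((\<circ>) a ` S) = 1"
        using inv[OF that sub] fa by (simp add: fin_add_prob_def)
    qed
    have mem: "R \<in> S" "\<sigma> \<circ> R \<in> S"
      using mem_S[OF id_mem, of 1] mem_S[OF \<sigma>, of 1] by simp_all
    let ?A = "(\<circ>) R ` S" and ?B = "(\<circ>) (\<sigma> \<circ> R) ` S"
    have "?A \<inter> ?B \<noteq> {}"
    proof
      assume disj: "?A \<inter> ?B = {}"
      have sub: "?A \<subseteq> S" "?B \<subseteq> S" "?A \<union> ?B \<subseteq> S" using ideal(1) mem by blast+
      have add: "\<mu> (X \<union> Y) = \<mu> X + \<mu> Y" if "X \<subseteq> S" "Y \<subseteq> S" "X \<inter> Y = {}" for X Y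
        using fa that by (simp add: fin_add_prob_def)
      have "\<mu> (?A \<union> ?B) = \<mu> ?A + \<mu> ?B"
        by (rule add[OF sub(1,2) disj])
      moreover have "\<mu> ((?A \<union> ?B) \<union> (S - (?A \<union> ?B))) = \<mu> (?A \<union> ?B) + \<mu> (S - (?A \<union> ?B))"
        by (rule add[OF sub(3)]) auto
      moreover have "(?A \<union> ?B) \<union> (S - (?A \<union> ?B)) = S"
        using sub(3) by (simp add: Un_absorb1)
      moreover have "\<mu> (S - (?A \<union> ?B)) \<ge> 0" "\<mu> S = 1"
        using fa by (auto simp: fin_add_prob_def)
      ultimately show False
        using ideal(2)[OF mem(1)] ideal(2)[OF mem(2)] by simp
    qed
    then obtain s t where st: "s \<in> S" "t \<in> S" "R \<circ> s = \<sigma> \<circ> R \<circ> t" by blast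
    obtain \<alpha> i where s: "\<alpha> \<in> \<Gamma>" "s = \<alpha> \<circ> R ^^ i" using S_normal_form st(1) by blast
    obtain \<beta> j where t: "\<beta> \<in> \<Gamma>" "t = \<beta> \<circ> R ^^ j" using S_normal_form st(2) by blast
    have "R \<circ> s = \<phi> \<alpha> \<circ> R ^^ Suc i"
      using s comp_normal[OF id_mem s(1), of 1 i] by simp
    moreover have "\<sigma> \<circ> R \<circ> t = (\<sigma> \<circ> \<phi> \<beta>) \<circ> R ^^ Suc j"
      using t comp_normal[OF \<sigma> t(1), of 1 j] by simp
    ultimately have "\<phi> \<alpha> = \<sigma> \<circ> \<phi> \<beta>"
      using normal_unique[of "\<phi> \<alpha>" "\<sigma> \<circ> \<phi> \<beta>"] st(3) s(1) t(1) \<sigma> phi_mem comp_mem by metis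
    \<comment> \<open>As \<open>\<phi>\<close> is multiplicative, solving for
      \<open>\<sigma>\<close> exhibits it as the image of
      \<open>\<alpha> \<circ> inv_into UNIV \<beta>\<close>.\<close>
    then have "\<phi> (\<alpha> \<circ> inv_into UNIV \<beta>) = \<sigma> \<circ> (\<phi> \<beta> \<circ> \<phi> (inv_into UNIV \<beta>))"
      by (simp only: phi_comp[OF s(1) inv_mem[OF t(1)]] comp_assoc)
    also have "\<phi> \<beta> \<circ> \<phi> (inv_into UNIV \<beta>) = \<phi> id"
      using phi_comp[OF t(1) inv_mem[OF t(1)]] bij_mem[OF t(1)]
      by (metis bij_is_surj surj_iff)
    also have "\<phi> id = id"
      using R_comp[OF id_mem] cancel_pow[of "\<phi> id" 1 id] by simp
    finally show "\<sigma> \<in> \<phi> ` \<Gamma>"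
      using comp_mem[OF s(1) inv_mem[OF t(1)]] by (intro image_eqI[of _ _ "\<alpha> \<circ> inv_into UNIV \<beta>"]) (simp_all only: comp_id)
  qed
qed

section \<open>Periodicity, cancellation and amenability when the twist permutes a finite
  group\<close>

context
  assumes fin: "finite \<Gamma>" and onto: "\<phi> ` \<Gamma> = \<Gamma>"
begin

lemma inj_phi_pow: "inj_on (\<phi> ^^ k) \<Gamma>"
proof (induction k)
  case (Suc k)
  have "inj_on \<phi> \<Gamma>" using fin onto by (simp add: eq_card_imp_inj_on)
  moreover have "(\<phi> ^^ k) ` \<Gamma> \<subseteq> \<Gamma>" using phi_pow_mem by blast
  ultimately show ?case
    using Suc unfolding funpow.simps by (intro comp_inj_on) (auto intro: inj_on_subset)
qed simp

text \<open>There are finitely many maps from \<open>\<Gamma>\<close> to itself, so two iterates of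
  \<open>\<phi>\<close> agree on \<open>\<Gamma>\<close>. Cancelling the smaller one by injectivity
  makes \<open>\<phi> ^^ m\<close> the identity on \<open>\<Gamma>\<close>, and then
  \<open>R ^^ m\<close> commutes with every normal form.\<close>

lemma central_iterate: "\<exists>m\<ge>1. \<forall>s\<in>S. s \<circ> R ^^ m = R ^^ m \<circ> s"
proof -
  have "finite (range (\<lambda>k. restrict (\<phi> ^^ k) \<Gamma>))"
    by (rule finite_subset[OF _ finite_PiE[OF fin, of "\<lambda>_. \<Gamma>"]])
      (use fin phi_pow_mem in \<open>auto simp del: restrict_apply intro!: restrict_PiE_iff[THEN iffD2]\<close>)
  then have "\<not> inj (\<lambda>k. restrict (\<phi> ^^ k) \<Gamma>)"
    using finite_imageD by blast
  then obtain i j where ij: "i < j" "restrict (\<phi> ^^ i) \<Gamma> = restrict (\<phi> ^^ j) \<Gamma>"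
    unfolding inj_def by (metis linorder_neqE_nat)
  define m where "m = j - i"
  have period: "(\<phi> ^^ m) \<sigma> = \<sigma>" if "\<sigma> \<in> \<Gamma>" for \<sigma>
  proof -
    have "(\<phi> ^^ i) ((\<phi> ^^ m) \<sigma>) = (\<phi> ^^ i) \<sigma>"
      using that fun_cong[OF ij(2), of \<sigma>] funpow_add[of i m \<phi>] ij(1)
      by (simp add: m_def restrict_apply' del: funpow_add)
    then show ?thesis
      using inj_phi_pow[of i] that phi_pow_mem by (meson inj_on_def)
  qed
  have "s \<circ> R ^^ m = R ^^ m \<circ> s" if sS: "s \<in> S" for s
  proof -
    obtain \<sigma> k where s: "\<sigma> \<in> \<Gamma>" "s = \<sigma> \<circ> R ^^ k" using S_normal_form sS by blast
    have "R ^^ m \<circ> s = \<sigma> \<circ> R ^^ (m + k)"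
      using comp_normal[OF id_mem s(1), of m k] period[OF s(1)] s(2) by simp
    then show ?thesis
      using s(2) by (simp add: comp_assoc funpow_add[symmetric] add.commute)
  qed
  moreover have "m \<ge> 1" using ij by (simp add: m_def)
  ultimately show ?thesis by blast
qed

text \<open>The map \<open>a\<close> itself need not be injective. Cancellation comes from the
  normal forms: exponents agree, and \<open>\<phi> ^^ k\<close> is injective on
  \<open>\<Gamma>\<close>.\<close>

lemma inj_comp_left: "inj_on ((\<circ>) a) S" if aS: "a \<in> S"
proof
  fix s t assume st: "s \<in> S" "t \<in> S" "a \<circ> s = a \<circ> t"
  obtain \<sigma> k where a: "\<sigma> \<in> \<Gamma>" "a = \<sigma> \<circ> R ^^ k" using S_normal_form aS by blast
  obtain \<alpha> i where s: "\<alpha> \<in> \<Gamma>" "s = \<alpha> \<circ> R ^^ i" using S_normal_form st(1) by blast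
  obtain \<beta> j where t: "\<beta> \<in> \<Gamma>" "t = \<beta> \<circ> R ^^ j" using S_normal_form st(2) by blast
  have eq: "(\<sigma> \<circ> (\<phi> ^^ k) \<alpha>) \<circ> R ^^ (k + i) = (\<sigma> \<circ> (\<phi> ^^ k) \<beta>) \<circ> R ^^ (k + j)"
    using st(3) comp_normal a s t by metis
  have mem: "\<sigma> \<circ> (\<phi> ^^ k) \<alpha> \<in> \<Gamma>" "\<sigma> \<circ> (\<phi> ^^ k) \<beta> \<in> \<Gamma>"
    using a s t comp_mem phi_pow_mem by blast+
  have "i = j" using exponent_unique[OF mem eq] by simp
  moreover have "(\<phi> ^^ k) \<alpha> = (\<phi> ^^ k) \<beta>"
    using normal_unique[OF mem eq] bij_is_inj[OF bij_mem[OF a(1)]] by (simp add: fun.inj_map inj_eq)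
  then have "\<alpha> = \<beta>" using inj_phi_pow[of k] s(1) t(1) by (meson inj_on_def)
  ultimately show "s = t" using s t by simp
qed

lemma inj_comp_right: "inj_on (\<lambda>s. s \<circ> a) S" if aS: "a \<in> S"
proof -
  obtain \<sigma> k where a: "\<sigma> \<in> \<Gamma>" "a = \<sigma> \<circ> R ^^ k" using S_normal_form aS by blast
  have "surj a"
    unfolding a(2) using bij_mem[OF a(1)] surj_pow by (metis bij_is_surj comp_surj)
  then show ?thesis by (metis inj_onI surj_fun_eq)
qed

text \<open>Exponents add under composition, and the elements of exponent \<open>k\<close> have the
  form \<open>\<sigma> \<circ> R ^^ k\<close>, so there are at most \<open>card \<Gamma>\<close> of
  them in any subsemigroup.\<close>

lemma subsemigroup_amenable:
  assumes "subsemigroup (\<circ>) T S"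
  shows "amenable (\<circ>) T"
proof (rule graded_amenable[where g = exponent and C = "card \<Gamma>"])
  show "T \<noteq> {}" and cl: "\<And>a b. a \<in> T \<Longrightarrow> b \<in> T \<Longrightarrow> a \<circ> b \<in> T"
    using assms unfolding subsemigroup_def by blast+
  have TS: "T \<subseteq> S" using assms unfolding subsemigroup_def by blast
  show "exponent (a \<circ> b) = exponent a + exponent b" if ab: "a \<in> T" "b \<in> T" for a b
  proof -
    obtain \<sigma> i where a: "\<sigma> \<in> \<Gamma>" "a = \<sigma> \<circ> R ^^ i" using S_normal_form ab(1) TS by blast
    obtain \<tau> j where b: "\<tau> \<in> \<Gamma>" "b = \<tau> \<circ> R ^^ j" using S_normal_form ab(2) TS by blast
    have "a \<circ> b = (\<sigma> \<circ> (\<phi> ^^ i) \<tau>) \<circ> R ^^ (i + j)"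
      unfolding a(2) b(2) by (rule comp_normal[OF a(1) b(1)])
    then show ?thesis
      using a b exponent_eq comp_mem phi_pow_mem by simp
  qed
  show "inj_on ((\<circ>) a) T" "inj_on (\<lambda>s. s \<circ> a) T" if "a \<in> T" for a
    using inj_comp_left inj_comp_right that TS by (meson inj_on_subset subsetD)+
  fix k
  have sub: "{s \<in> T. exponent s = k} \<subseteq> (\<lambda>\<sigma>. \<sigma> \<circ> R ^^ k) ` \<Gamma>"
  proof
    fix s assume s: "s \<in> {s \<in> T. exponent s = k}"
    then obtain \<sigma> i where "\<sigma> \<in> \<Gamma>" "s = \<sigma> \<circ> R ^^ i" using S_normal_form TS by blast
    with s show "s \<in> (\<lambda>\<sigma>. \<sigma> \<circ> R ^^ k) ` \<Gamma>" using exponent_eq by auto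
  qed
  show "finite {s \<in> T. exponent s = k}"
    using sub fin finite_surj by blast
  show "card {s \<in> T. exponent s = k} \<le> card \<Gamma>"
    using sub fin by (rule surj_card_le[rotated])
qed

end

end

section \<open>Rational maps of the Riemann sphere\<close>

text \<open>The point \<open>[x : y]\<close> in homogeneous coordinates. The pair
  \<open>(0, 0)\<close> gets the default value \<open>Infty\<close>, hence the nonvanishing
  conditions below.\<close>

definition pt :: "complex \<Rightarrow> complex \<Rightarrow> cp1" where
  "pt x y = (if y = 0 then Infty else Fin (x / y))"

lemma pt_eq_iff:
  assumes "x \<noteq> 0 \<or> y \<noteq> 0" "u \<noteq> 0 \<or> v \<noteq> 0"
  shows "pt x y = pt u v \<longleftrightarrow> x * v = u * y"
  using assms by (auto simp: pt_def field_simps)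

lemma pt_scale: "k \<noteq> 0 \<Longrightarrow> pt (k * x) (k * y) = pt x y"
  by (auto simp: pt_def)

lemma pt_cases:
  obtains x y where "x \<noteq> 0 \<or> y \<noteq> 0" "w = pt x y"
proof (cases w)
  case (Fin z) then show ?thesis using that[of z 1] by (simp add: pt_def)
next
  case Infty then show ?thesis using that[of 1 0] by (simp add: pt_def)
qed

lemma infinite_cp1: "infinite (UNIV :: cp1 set)"
proof
  assume "finite (UNIV :: cp1 set)"
  then have "finite (range Fin)" by (rule rev_finite_subset) simp
  then have "finite (UNIV :: complex set)"
    by (rule finite_imageD) (simp add: inj_on_def)
  then show False by (simp add: infinite_UNIV_char_0)
qed

lemma rat_map_Fin: "rat_map p q (Fin z) = pt (poly p z) (poly q z)"
  by (simp add: pt_def)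

lemma rat_map_Infty:
  "rat_map p q Infty = pt (coeff p (max (degree p) (degree q))) (coeff q (max (degree p) (degree q)))"
  by (simp add: pt_def Let_def)

declare rat_map.simps [simp del]

text \<open>This is the absence of common zeros of the two homogenizations at
  \<open>[1 : 0]\<close>. If \<open>p\<close> is zero, coprimality makes \<open>q\<close> a nonzero
  constant and \<open>d = 0\<close>.\<close>

lemma coprime_top_coeff:
  fixes p q :: "complex poly"
  assumes "coprime p q" "max (degree p) (degree q) = d"
  shows "coeff p d \<noteq> 0 \<or> coeff q d \<noteq> 0"
proof (cases "degree p = d")
  case True
  show ?thesis
  proof (cases "p = 0")
    case True
    then have "is_unit q" "q \<noteq> 0" using assms(1) by auto
    then have "degree q = 0" by (simp add: is_unit_iff_degree)
    then show ?thesis using assms(2) True leading_coeff_neq_0[of q] \<open>q \<noteq> 0\<close> by simp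
  next
    case False then show ?thesis using True leading_coeff_neq_0[of p] by simp
  qed
next
  case False
  then have "degree q = d" "d \<noteq> 0" using assms(2) by auto
  then show ?thesis by (metis degree_0 leading_coeff_0_iff)
qed

lemma coprimeI_no_common_root:
  fixes p q :: "complex poly"
  assumes "\<And>z. poly p z = 0 \<Longrightarrow> poly q z \<noteq> 0"
  shows "coprime p q"
proof (rule ccontr)
  assume "\<not> coprime p q"
  then obtain c where c: "c dvd p" "c dvd q" "\<not> is_unit c"
    by (rule not_coprimeE)
  have "\<exists>z. poly c z = 0"
  proof (cases "c = 0")
    case False
    with c(3) have "degree c \<noteq> 0" by (simp add: is_unit_iff_degree)
    then show ?thesis
      using fundamental_theorem_of_algebra[of c] by (auto simp: constant_degree)
  qed simp
  then obtain z where "poly c z = 0" ..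
  with c(1,2) have "poly p z = 0" "poly q z = 0" by (auto elim!: dvdE)
  with assms show False by blast
qed

text \<open>Homogenization in degree \<open>d\<close>, evaluated at a pair of numbers and at a pair of polynomials.\<close>

definition hom_eval :: "nat \<Rightarrow> complex poly \<Rightarrow> complex \<Rightarrow> complex \<Rightarrow> complex" where
  "hom_eval d p x y = (\<Sum>i\<le>d. coeff p i * (x ^ i * y ^ (d - i)))"

definition hom_subst :: "nat \<Rightarrow> complex poly \<Rightarrow> complex poly \<Rightarrow> complex poly \<Rightarrow> complex poly" where
  "hom_subst d p r s = (\<Sum>i\<le>d. smult (coeff p i) (r ^ i * s ^ (d - i)))"

lemma poly_hom_subst: "poly (hom_subst d p r s) z = hom_eval d p (poly r z) (poly s z)"
  by (simp add: hom_subst_def hom_eval_def poly_sum)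

lemma hom_eval_0: "hom_eval d p x 0 = coeff p d * x ^ d"
proof -
  have "hom_eval d p x 0 = (\<Sum>i\<in>{d}. coeff p i * (x ^ i * 0 ^ (d - i)))"
    unfolding hom_eval_def by (intro sum.mono_neutral_right) auto
  then show ?thesis by simp
qed

lemma hom_eval_nz:
  assumes "degree p \<le> d" "y \<noteq> 0"
  shows "hom_eval d p x y = y ^ d * poly p (x / y)"
proof -
  have "poly p (x / y) = (\<Sum>i\<le>d. coeff p i * (x / y) ^ i)"
    unfolding poly_altdef using assms(1)
    by (intro sum.mono_neutral_left) (auto simp: coeff_eq_0)
  then have "y ^ d * poly p (x / y) = (\<Sum>i\<le>d. y ^ d * (coeff p i * (x / y) ^ i))"
    by (simp add: sum_distrib_left)
  also have "\<dots> = hom_eval d p x y"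
    unfolding hom_eval_def
  proof (rule sum.cong)
    fix i assume "i \<in> {..d}"
    then have "y ^ d = y ^ i * y ^ (d - i)" by (simp flip: power_add)
    then show "y ^ d * (coeff p i * (x / y) ^ i) = coeff p i * (x ^ i * y ^ (d - i))"
      using assms(2) by (simp add: power_divide)
  qed simp
  finally show ?thesis by simp
qed

lemma hom_eval_not_both_zero:
  assumes "coprime p q" "max (degree p) (degree q) = d" "x \<noteq> 0 \<or> y \<noteq> 0"
  shows "hom_eval d p x y \<noteq> 0 \<or> hom_eval d q x y \<noteq> 0"
proof (cases "y = 0")
  case True
  then show ?thesis using assms coprime_top_coeff[OF assms(1,2)] by (auto simp: hom_eval_0)
next
  case False
  then show ?thesis
    using assms coprime_poly_0[OF assms(1), of "x / y"] by (auto simp: hom_eval_nz)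
qed

lemma rat_map_pt:
  assumes "max (degree p) (degree q) = d" "x \<noteq> 0 \<or> y \<noteq> 0"
  shows "rat_map p q (pt x y) = pt (hom_eval d p x y) (hom_eval d q x y)"
proof (cases "y = 0")
  case True
  then have "rat_map p q (pt x y) = pt (coeff p d) (coeff q d)"
    using assms rat_map_Infty[of p q] by (simp add: pt_def)
  then show ?thesis
    using True assms pt_scale[of "x ^ d" "coeff p d" "coeff q d"]
    by (simp add: hom_eval_0 mult.commute)
next
  case False
  then have "rat_map p q (pt x y) = pt (poly p (x / y)) (poly q (x / y))"
    using rat_map_Fin[of p q "x / y"] by (simp add: pt_def)
  then show ?thesis
    using False assms pt_scale[of "y ^ d" "poly p (x / y)" "poly q (x / y)"]
    by (simp add: hom_eval_nz)
qed

section \<open>Degree and coprimality under composition\<close>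

lemma coeff_mult_at_bound:
  fixes p q :: "complex poly"
  assumes "degree p \<le> m" "degree q \<le> n"
  shows "coeff (p * q) (m + n) = coeff p m * coeff q n"
proof -
  have "coeff (p * q) (m + n) = (\<Sum>i\<in>{m}. coeff p i * coeff q (m + n - i))"
    unfolding coeff_mult using assms
    by (intro sum.mono_neutral_right) (force intro: coeff_eq_0)+
  then show ?thesis by simp
qed

lemma coeff_power_at_bound:
  fixes p :: "complex poly"
  assumes "degree p \<le> m"
  shows "coeff (p ^ i) (i * m) = coeff p m ^ i" "degree (p ^ i) \<le> i * m"
proof -
  show deg: "degree (p ^ i) \<le> i * m" for i
    by (metis assms degree_power_le le_trans mult.commute mult_le_mono1)
  show "coeff (p ^ i) (i * m) = coeff p m ^ i"
  proof (induction i)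
    case (Suc i)
    have "coeff (p * p ^ i) (m + i * m) = coeff p m * coeff (p ^ i) (i * m)"
      by (rule coeff_mult_at_bound[OF assms deg])
    then show ?case using Suc by simp
  qed simp
qed

text \<open>Each summand \<open>r ^ i * s ^ (a - i)\<close> has degree at most
  \<open>i * b + (a - i) * b = a * b\<close>, so its coefficient there is the product of the top
  coefficients. This describes the composite at infinity.\<close>

lemma hom_subst_top:
  assumes "degree r \<le> b" "degree s \<le> b"
  shows "coeff (hom_subst a p r s) (a * b) = hom_eval a p (coeff r b) (coeff s b)"
    and "degree (hom_subst a p r s) \<le> a * b"
proof -
  have ab: "i * b + (a - i) * b = a * b" if "i \<le> a" for i
    using that by (simp flip: add_mult_distrib)
  have "coeff (r ^ i * s ^ (a - i)) (a * b) = coeff r b ^ i * coeff s b ^ (a - i)"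
    if "i \<le> a" for i
    using coeff_mult_at_bound[OF coeff_power_at_bound(2)[OF assms(1), of i]
        coeff_power_at_bound(2)[OF assms(2), of "a - i"]]
    by (simp add: coeff_power_at_bound(1) assms ab[OF that])
  then show "coeff (hom_subst a p r s) (a * b) = hom_eval a p (coeff r b) (coeff s b)"
    by (simp add: hom_subst_def hom_eval_def coeff_sum)
  have "degree (r ^ i * s ^ (a - i)) \<le> a * b" if "i \<le> a" for i
    using degree_mult_le[of "r ^ i" "s ^ (a - i)"] coeff_power_at_bound(2)[OF assms(1), of i]
      coeff_power_at_bound(2)[OF assms(2), of "a - i"] ab[OF that] by linarith
  then show "degree (hom_subst a p r s) \<le> a * b"
    unfolding hom_subst_def
    by (intro degree_sum_le) (auto intro: order_trans[OF degree_smult_le])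
qed

text \<open>Substituting into homogenizations causes no cancellation: a common root of
  \<open>P\<close> and \<open>Q\<close> would give a common zero of the homogenized \<open>p\<close>
  and \<open>q\<close> at a nonzero pair. The same argument at infinity shows that the degree does
  not drop below \<open>a * b\<close>.\<close>

lemma rational_comp:
  assumes "rational_of_degree a f" "rational_of_degree b g"
  shows "rational_of_degree (a * b) (f \<circ> g)"
proof -
  obtain p q where pq: "coprime p q" "max (degree p) (degree q) = a" "f = rat_map p q"
    using assms(1) unfolding rational_of_degree_def by blast
  obtain r s where rs: "coprime r s" "max (degree r) (degree s) = b" "g = rat_map r s"
    using assms(2) unfolding rational_of_degree_def by blast
  define P where "P = hom_subst a p r s"
  define Q where "Q = hom_subst a q r s"
  have deg: "degree r \<le> b" "degree s \<le> b" using rs by auto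
  have rsz: "poly r z \<noteq> 0 \<or> poly s z \<noteq> 0" for z
    using rs(1) by (rule coprime_poly_0)
  have cop: "coprime P Q"
    using hom_eval_not_both_zero[OF pq(1,2) rsz]
    by (intro coprimeI_no_common_root) (auto simp: P_def Q_def poly_hom_subst)
  have top: "coeff P (a * b) = hom_eval a p (coeff r b) (coeff s b)"
    "coeff Q (a * b) = hom_eval a q (coeff r b) (coeff s b)"
    by (simp_all add: P_def Q_def hom_subst_top deg)
  have rsb: "coeff r b \<noteq> 0 \<or> coeff s b \<noteq> 0"
    by (rule coprime_top_coeff[OF rs(1,2)])
  have "coeff P (a * b) \<noteq> 0 \<or> coeff Q (a * b) \<noteq> 0"
    unfolding top by (rule hom_eval_not_both_zero[OF pq(1,2) rsb])
  moreover have "degree P \<le> a * b" "degree Q \<le> a * b"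
    by (simp_all add: P_def Q_def hom_subst_top deg)
  ultimately have max: "max (degree P) (degree Q) = a * b"
    by (meson antisym le_degree le_max_iff_disj max.boundedI)
  have "(f \<circ> g) w = rat_map P Q w" for w
  proof (cases w)
    case (Fin z)
    then show ?thesis
      using rat_map_pt[OF pq(2) rsz[of z]] by (simp add: rat_map_Fin pq rs P_def Q_def poly_hom_subst)
  next
    case Infty
    then show ?thesis
      using rat_map_pt[OF pq(2) rsb] by (simp add: rat_map_Infty max rs(2) top pq(3) rs(3))
  qed
  then show ?thesis
    unfolding rational_of_degree_def using cop max by blast
qed

section \<open>Moebius transformations: inverses, transitivity and rigidity\<close>

lemma moebius_iff_degree_1: "moebius \<sigma> \<longleftrightarrow> rational_of_degree 1 \<sigma>"
proof
  assume "moebius \<sigma>"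
  then obtain a b c d where det: "a * d - b * c \<noteq> 0" and \<sigma>: "\<sigma> = rat_map [:b, a:] [:d, c:]"
    unfolding moebius_def by blast
  have "coprime [:b, a:] [:d, c:]"
  proof (rule coprimeI_no_common_root)
    fix z assume z: "poly [:b, a:] z = 0"
    show "poly [:d, c:] z \<noteq> 0"
    proof
      assume "poly [:d, c:] z = 0"
      with z have "b = - (z * a)" "d = - (z * c)" by (simp_all add: eq_neg_iff_add_eq_0)
      then show False using det by simp
    qed
  qed
  moreover have "max (degree [:b, a:]) (degree [:d, c:]) = 1" using det by auto
  ultimately show "rational_of_degree 1 \<sigma>"
    unfolding rational_of_degree_def \<sigma> by blast
next
  assume "rational_of_degree 1 \<sigma>"
  then obtain p q where pq: "coprime p q" "max (degree p) (degree q) = 1" "\<sigma> = rat_map p q"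
    unfolding rational_of_degree_def by blast
  have lin: "\<exists>a b. r = [:b, a:]" if "degree r \<le> 1" for r :: "complex poly"
    using that by (metis degree1_coeffs degree_eq_zeroE le_neq_implies_less less_one pCons_0_0)
  have "degree p \<le> 1" "degree q \<le> 1" using pq(2) by linarith+
  then obtain a b c d where p: "p = [:b, a:]" and q: "q = [:d, c:]"
    using lin by meson
  have "a * d - b * c \<noteq> 0"
  proof
    assume det: "a * d - b * c = 0"
    have ac: "a \<noteq> 0 \<or> c \<noteq> 0" using pq(2) p q by auto
    have "\<exists>z. poly p z = 0 \<and> poly q z = 0"
    proof (cases "a = 0")
      case True
      then show ?thesis
        using ac det by (intro exI[of _ "- d / c"]) (auto simp: p q)
    next
      case False
      then show ?thesis
        using det by (intro exI[of _ "- b / a"]) (auto simp: p q field_simps)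
    qed
    then show False using coprime_poly_0[OF pq(1)] by blast
  qed
  then show "moebius \<sigma>" unfolding moebius_def using pq(3) p q by blast
qed

lemma moebius_comp: "moebius \<sigma> \<Longrightarrow> moebius \<tau> \<Longrightarrow> moebius (\<sigma> \<circ> \<tau>)"
  using rational_comp[of 1 \<sigma> 1 \<tau>] by (simp add: moebius_iff_degree_1)

lemma rational_moebius_comp: "moebius \<sigma> \<Longrightarrow> rational_of_degree n f \<Longrightarrow> rational_of_degree n (\<sigma> \<circ> f)"
  using rational_comp[of 1 \<sigma> n f] by (simp add: moebius_iff_degree_1)

lemma rational_comp_moebius: "moebius \<sigma> \<Longrightarrow> rational_of_degree n f \<Longrightarrow> rational_of_degree n (f \<circ> \<sigma>)"
  using rational_comp[of n f 1 \<sigma>] by (simp add: moebius_iff_degree_1)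

lemma moebius_pt:
  assumes "a * d - b * c \<noteq> 0" "x \<noteq> 0 \<or> y \<noteq> 0"
  shows "rat_map [:b, a:] [:d, c:] (pt x y) = pt (a * x + b * y) (c * x + d * y)"
proof -
  have "max (degree [:b, a:]) (degree [:d, c:]) = 1" using assms(1) by auto
  then show ?thesis
    using rat_map_pt[OF _ assms(2)] by (simp add: hom_eval_def add.commute)
qed

lemma moebius_pt_nonzero:
  fixes a b c d x y :: complex
  assumes "a * d - b * c \<noteq> 0" "x \<noteq> 0 \<or> y \<noteq> 0"
  shows "a * x + b * y \<noteq> 0 \<or> c * x + d * y \<noteq> 0"
proof (rule ccontr)
  assume "\<not> ?thesis"
  then have z: "a * x + b * y = 0" "c * x + d * y = 0" by auto
  have "(a * d - b * c) * x = d * (a * x + b * y) - b * (c * x + d * y)"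
    "(a * d - b * c) * y = a * (c * x + d * y) - c * (a * x + b * y)"
    by (simp_all add: algebra_simps)
  with z assms show False by simp
qed

lemma moebius_right_inverse: "moebius \<sigma> \<Longrightarrow> \<exists>\<tau>. moebius \<tau> \<and> \<sigma> \<circ> \<tau> = id"
proof -
  assume "moebius \<sigma>"
  then obtain a b c d where det: "a * d - b * c \<noteq> 0" and \<sigma>: "\<sigma> = rat_map [:b, a:] [:d, c:]"
    unfolding moebius_def by blast
  \<comment> \<open>The adjugate matrix; its product with the matrix of \<open>\<sigma>\<close> is
    the determinant times the identity, and \<open>pt_scale\<close> removes the factor.\<close>
  define \<tau> where "\<tau> = rat_map [:- b, d:] [:a, - c:]"
  have det': "d * a - (- b) * (- c) \<noteq> 0" using det by (simp add: mult.commute)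
  have "(\<sigma> \<circ> \<tau>) w = w" for w
  proof -
    obtain x y where xy: "x \<noteq> 0 \<or> y \<noteq> 0" "w = pt x y" by (rule pt_cases)
    have "\<tau> w = pt (d * x + - b * y) (- c * x + a * y)"
      unfolding \<tau>_def xy(2) by (rule moebius_pt[OF det' xy(1)])
    then have "\<sigma> (\<tau> w) = pt (a * (d * x + - b * y) + b * (- c * x + a * y))
        (c * (d * x + - b * y) + d * (- c * x + a * y))"
      unfolding \<sigma> using moebius_pt[OF det moebius_pt_nonzero[OF det' xy(1)]] by simp
    also have "\<dots> = pt ((a * d - b * c) * x) ((a * d - b * c) * y)"
      by (simp add: algebra_simps)
    also have "\<dots> = w" using det xy(2) by (simp add: pt_scale)
    finally show ?thesis by simp
  qed
  moreover have "moebius \<tau>" using det' unfolding moebius_def \<tau>_def by blast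
  ultimately show ?thesis by (intro exI[of _ \<tau>]) (auto simp: fun_eq_iff)
qed

text \<open>A right inverse \<open>\<tau>\<close> has a right inverse \<open>\<rho>\<close> in turn,
  and \<open>\<rho> = \<sigma>\<close> by associativity, so \<open>\<tau>\<close> is
  two-sided.\<close>

lemma moebius_bij_inv:
  assumes "moebius \<sigma>"
  shows "bij \<sigma>" "moebius (inv_into UNIV \<sigma>)"
proof -
  obtain \<tau> where \<tau>: "moebius \<tau>" "\<sigma> \<circ> \<tau> = id" using moebius_right_inverse assms by blast
  obtain \<rho> where \<rho>: "moebius \<rho>" "\<tau> \<circ> \<rho> = id" using moebius_right_inverse \<tau>(1) by blast
  have "\<rho> = \<sigma>" by (metis \<tau>(2) \<rho>(2) comp_assoc comp_id id_comp)
  then have \<tau>': "\<tau> \<circ> \<sigma> = id" using \<rho>(2) by simp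
  show "bij \<sigma>" using \<tau>(2) \<tau>' by (rule o_bij[rotated])
  show "moebius (inv_into UNIV \<sigma>)" using \<tau> \<tau>' by (metis inv_unique_comp)
qed

lemma moebius_id: "moebius id"
proof -
  have "rat_map [:0, 1:] [:1, 0:] w = id w" for w
    using moebius_pt[of 1 1 0 0] by (cases w rule: pt_cases) simp
  then have "id = rat_map [:0, 1:] [:1, 0:]" by auto
  then show ?thesis unfolding moebius_def by (metis diff_zero mult_1 mult_zero_left zero_neq_one)
qed

lemma moebius_0_Infty:
  assumes "x \<noteq> y"
  shows "\<exists>\<sigma>. moebius \<sigma> \<and> \<sigma> x = Fin 0 \<and> \<sigma> y = Infty"
proof -
  obtain x1 x2 where x: "x1 \<noteq> 0 \<or> x2 \<noteq> 0" "x = pt x1 x2" by (rule pt_cases)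
  obtain y1 y2 where y: "y1 \<noteq> 0 \<or> y2 \<noteq> 0" "y = pt y1 y2" by (rule pt_cases)
  have det: "x2 * (- y1) - (- x1) * y2 \<noteq> 0"
    using assms x y pt_eq_iff[of x1 x2 y1 y2] by (auto simp: mult.commute)
  \<comment> \<open>Numerator and denominator are the linear forms vanishing at \<open>x\<close> and
    at \<open>y\<close>; they are proportional only if \<open>x = y\<close>.\<close>
  define \<sigma> where "\<sigma> = rat_map [:- x1, x2:] [:- y1, y2:]"
  have "moebius \<sigma>" unfolding moebius_def \<sigma>_def using det by blast
  moreover have "\<sigma> x = Fin 0"
    using det moebius_pt[OF det x(1)] by (auto simp: \<sigma>_def x(2) pt_def mult.commute)
  moreover have "\<sigma> y = Infty"
    using det moebius_pt[OF det y(1)] by (auto simp: \<sigma>_def y(2) pt_def mult.commute)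
  ultimately show ?thesis by blast
qed

text \<open>Finite fixed points are roots of \<open>c z\<^sup>2 + (d - a) z - b\<close>. If
  \<open>c\<close> is nonzero, \<open>Infty\<close> is not fixed and two roots are too few. If
  \<open>c = 0\<close>, at least two finite fixed points remain for a polynomial of degree at most
  one, which must vanish.\<close>

lemma moebius_fixing_3:
  assumes "moebius \<sigma>" "card A \<ge> 3" "\<And>x. x \<in> A \<Longrightarrow> \<sigma> x = x"
  shows "\<sigma> = id"
proof -
  obtain a b c d where det: "a * d - b * c \<noteq> 0" and \<sigma>: "\<sigma> = rat_map [:b, a:] [:d, c:]"
    using assms(1) unfolding moebius_def by blast
  define Z where "Z = Fin -` A"
  have A: "A \<subseteq> insert Infty (Fin ` Z)"
  proof
    fix w assume "w \<in> A" then show "w \<in> insert Infty (Fin ` Z)" by (cases w) (auto simp: Z_def)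
  qed
  have Z: "c * z\<^sup>2 + (d - a) * z - b = 0" if "z \<in> Z" for z
  proof -
    have "pt (a * z + b) (c * z + d) = pt z 1"
      using moebius_pt[OF det, of z 1] assms(3)[of "Fin z"] that by (simp add: Z_def \<sigma> pt_def)
    then have "(a * z + b) * 1 = z * (c * z + d)"
      using pt_eq_iff moebius_pt_nonzero[OF det, of z 1] by simp
    then show ?thesis by (simp add: algebra_simps power2_eq_square)
  qed
  have "finite A" using assms(2) by (metis card.infinite not_numeral_le_zero)
  then have finZ: "finite Z" unfolding Z_def by (rule finite_vimageI) (simp add: inj_def)
  have cardZ: "card (Fin ` Z) = card Z" by (rule card_image) (simp add: inj_on_def)
  have "Z \<subseteq> {z. poly [:- b, d - a, c:] z = 0}"
    using Z by (auto simp: algebra_simps power2_eq_square)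
  then have bound: "card Z \<le> degree [:- b, d - a, c:]" if nz: "[:- b, d - a, c:] \<noteq> 0"
    using card_mono[OF poly_roots_finite[OF nz]] card_poly_roots_bound[OF nz] by (meson le_trans)
  have c: "c = 0"
  proof (rule ccontr)
    assume "c \<noteq> 0"
    have "Infty \<notin> A"
    proof
      assume "Infty \<in> A"
      then show False
        using assms(3)[of Infty] moebius_pt[OF det, of 1 0] \<open>c \<noteq> 0\<close> by (simp add: \<sigma> pt_def)
    qed
    then have "card A \<le> card (Fin ` Z)"
      using A finZ by (intro card_mono) auto
    then show False
      using bound \<open>c \<noteq> 0\<close> assms(2) cardZ by simp
  qed
  have "card A \<le> card (insert Infty (Fin ` Z))"
    using finZ A by (intro card_mono) auto
  also have "\<dots> \<le> Suc (card Z)"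
    using finZ cardZ by (simp add: card_insert_if)
  finally have "card Z \<ge> 2" using assms(2) by linarith
  moreover have "degree [:- b, d - a, c:] \<le> 1" using c by simp
  ultimately have "[:- b, d - a, c:] = 0" using bound by linarith
  then have coeffs: "b = 0" "d = a" by auto
  then have "a \<noteq> 0" using det c by auto
  have "\<sigma> w = w" for w
  proof -
    obtain x y where xy: "x \<noteq> 0 \<or> y \<noteq> 0" "w = pt x y" by (rule pt_cases)
    then show ?thesis
      using moebius_pt[OF det xy(1)] coeffs \<open>a \<noteq> 0\<close> c by (simp add: \<sigma> pt_scale)
  qed
  then show ?thesis by (auto simp: fun_eq_iff)
qed

lemma moebius_eq_on_3:
  assumes "moebius \<sigma>" "moebius \<tau>" "card A \<ge> 3" "\<And>x. x \<in> A \<Longrightarrow> \<sigma> x = \<tau> x"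
  shows "\<sigma> = \<tau>"
proof -
  have "inv_into UNIV \<tau> \<circ> \<sigma> = id"
    using assms moebius_bij_inv[OF assms(2)]
    by (intro moebius_fixing_3[of _ A]) (auto simp: moebius_comp bij_is_inj)
  then show ?thesis
    using moebius_bij_inv(1)[OF assms(2)] by (metis bij_is_surj comp_assoc id_comp surj_iff comp_id)
qed

text \<open>A Moebius transformation is determined by its restriction to three points, and there are
  finitely many maps from \<open>A\<close> to \<open>V\<close>.\<close>

lemma finite_moebius_image:
  assumes "card A \<ge> 3" "finite V"
  shows "finite {\<sigma>. moebius \<sigma> \<and> \<sigma> ` A \<subseteq> V}"
proof -
  have "finite A" using assms(1) by (metis card.infinite not_numeral_le_zero)
  then have "finite (A \<rightarrow>\<^sub>E V)" using assms(2) by (intro finite_PiE)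
  moreover have "(\<lambda>\<sigma>. restrict \<sigma> A) ` {\<sigma>. moebius \<sigma> \<and> \<sigma> ` A \<subseteq> V} \<subseteq> A \<rightarrow>\<^sub>E V"
    by auto
  moreover have "inj_on (\<lambda>\<sigma>. restrict \<sigma> A) {\<sigma>. moebius \<sigma> \<and> \<sigma> ` A \<subseteq> V}"
  proof
    fix \<sigma> \<tau> assume *: "\<sigma> \<in> {\<sigma>. moebius \<sigma> \<and> \<sigma> ` A \<subseteq> V}" "\<tau> \<in> {\<sigma>. moebius \<sigma> \<and> \<sigma> ` A \<subseteq> V}"
      "restrict \<sigma> A = restrict \<tau> A"
    then have "\<sigma> x = \<tau> x" if "x \<in> A" for x
      using that by (metis restrict_apply')
    with * show "\<sigma> = \<tau>" using moebius_eq_on_3[OF _ _ assms(1)] by blast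
  qed
  ultimately show ?thesis by (meson inj_on_finite)
qed

section \<open>Small fibres and the Wronskian\<close>

text \<open>The fibre over \<open>[u : v]\<close> is the zero set of a form of degree
  \<open>n\<close>; infinity belongs to it when the coefficient of index \<open>n\<close>
  vanishes.\<close>

lemma fibre_eq:
  assumes "coprime p q" "max (degree p) (degree q) = n" "u \<noteq> 0 \<or> v \<noteq> 0"
  shows "rat_map p q -` {pt u v} =
    Fin ` {z. poly (smult v p - smult u q) z = 0} \<union>
    (if coeff (smult v p - smult u q) n = 0 then {Infty} else {})"
proof -
  have "rat_map p q w = pt u v \<longleftrightarrow> w \<in> Fin ` {z. poly (smult v p - smult u q) z = 0} \<union>
    (if coeff (smult v p - smult u q) n = 0 then {Infty} else {})" for w
  proof (cases w)
    case (Fin z)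
    then show ?thesis
      using pt_eq_iff[OF coprime_poly_0[OF assms(1)] assms(3)]
      by (auto simp: rat_map_Fin mult.commute)
  next
    case Infty
    then show ?thesis
      using pt_eq_iff[OF coprime_top_coeff[OF assms(1,2)] assms(3)] assms(2)
      by (auto simp: rat_map_Infty mult.commute)
  qed
  then show ?thesis by auto
qed

text \<open>If \<open>v p = u q\<close> with \<open>v\<close> nonzero, then \<open>q\<close> divides
  \<open>p\<close>. Coprimality makes \<open>q\<close>, and with it \<open>p\<close>,
  constant.\<close>

lemma pencil_nonzero:
  fixes p q :: "complex poly"
  assumes "coprime p q" "max (degree p) (degree q) \<ge> 1" "u \<noteq> 0 \<or> v \<noteq> 0"
  shows "smult v p - smult u q \<noteq> 0"
proof
  have *: False if "coprime p q" "max (degree p) (degree q) \<ge> 1" "v \<noteq> 0" "smult v p = smult u q"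
    for p q :: "complex poly" and u v
  proof -
    have "smult (1 / v) (smult v p) = smult (u / v) q" by (simp add: that(4))
    then have p: "p = smult (u / v) q" using that(3) by simp
    then have "q dvd p" by (metis dvd_refl dvd_smult)
    then have "is_unit q" using that(1) by (metis coprime_absorb_right)
    then have "degree q = 0" by (metis is_unit_iff_degree not_is_unit_0)
    then show False using p that(2) by (auto split: if_splits)
  qed
  assume "smult v p - smult u q = 0"
  then have eq: "smult v p = smult u q" by simp
  show False
  proof (cases "v = 0")
    case False then show False using * assms eq by blast
  next
    case True
    then show False
      using *[of q p u v] assms eq by (simp add: coprime_commute max.commute)
  qed
qed

lemma degree_eq_sum_orders:
  fixes P :: "complex poly"
  assumes "P \<noteq> 0"
  shows "degree P = (\<Sum>z | poly P z = 0. order z P)"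
proof -
  have "degree P = size (proots P)" by (simp add: size_proots_complex)
  also have "\<dots> = (\<Sum>z | poly P z = 0. order z P)"
    using assms by (simp add: size_multiset_overloaded_eq)
  finally show ?thesis .
qed

lemma card_roots_lt_degree:
  fixes P :: "complex poly"
  assumes "P \<noteq> 0" "poly P z = 0" "poly (pderiv P) z = 0"
  shows "card {x. poly P x = 0} < degree P"
proof -
  have ge: "order x P \<ge> 1" if "poly P x = 0" for x
    using that assms(1) by (simp add: order_root Suc_le_eq)
  have "degree P \<noteq> 0"
  proof
    assume "degree P = 0"
    then obtain c where "P = [:c:]" by (rule degree_eq_zeroE)
    then show False using assms by simp
  qed
  then have "pderiv P \<noteq> 0" by (simp add: pderiv_eq_0_iff)
  moreover from this have "order z (pderiv P) \<ge> 1"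
    using assms(3) by (simp add: order_root Suc_le_eq)
  ultimately have "order z P > 1"
    using order_pderiv[of P z] ge[OF assms(2)] assms by simp
  then have "(\<Sum>x | poly P x = 0. 1) < (\<Sum>x | poly P x = 0. order x P)"
    using ge assms poly_roots_finite[OF assms(1)] by (intro sum_strict_mono_ex1) auto
  then show ?thesis by (simp add: degree_eq_sum_orders[OF assms(1)])
qed

lemma card_roots_eq_degree:
  fixes P :: "complex poly"
  assumes "P \<noteq> 0" "\<And>z. poly P z = 0 \<Longrightarrow> poly (pderiv P) z \<noteq> 0"
  shows "card {x. poly P x = 0} = degree P"
proof -
  have "rsquarefree P" using assms(2) by (auto simp: rsquarefree_roots)
  then have "order x P = 1" if "poly P x = 0" for x
    using that assms(1) by (intro rsquarefree_root_order)
  then show ?thesis by (simp add: degree_eq_sum_orders[OF assms(1)])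
qed

text \<open>Infinity contributes one point exactly when the degree drops. A fibre therefore has
  fewer than \<open>n\<close> points only if \<open>P\<close> has a multiple root or degree at most
  \<open>n - 2\<close>.\<close>

lemma card_fibre:
  fixes p q :: "complex poly"
  assumes "coprime p q" "max (degree p) (degree q) = n" "n \<ge> 1" "u \<noteq> 0 \<or> v \<noteq> 0"
  defines "P \<equiv> smult v p - smult u q"
  shows "finite (rat_map p q -` {pt u v})"
    and "card (rat_map p q -` {pt u v}) = card {z. poly P z = 0} + (if degree P < n then 1 else 0)"
    and "degree P \<le> n" "P \<noteq> 0"
proof -
  show nz: "P \<noteq> 0" unfolding P_def using assms by (intro pencil_nonzero) auto
  show deg: "degree P \<le> n"
    unfolding P_def using assms(2) by (intro degree_diff_le) (auto intro: order_trans[OF degree_smult_le])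
  have top: "coeff P n = 0 \<longleftrightarrow> degree P < n"
    using deg nz by (metis coeff_eq_0 le_neq_implies_less leading_coeff_0_iff)
  have fin: "finite {z. poly P z = 0}" by (rule poly_roots_finite[OF nz])
  note fib = fibre_eq[OF assms(1,2,4), folded P_def, unfolded top]
  show "finite (rat_map p q -` {pt u v})" unfolding fib using fin by simp
  have "card (Fin ` {z. poly P z = 0}) = card {z. poly P z = 0}"
    by (rule card_image) (simp add: inj_on_def)
  then show "card (rat_map p q -` {pt u v}) = card {z. poly P z = 0} + (if degree P < n then 1 else 0)"
    unfolding fib using fin by (auto simp: card_insert_if)
qed

lemma fibre_finite_nonempty:
  assumes "rational_of_degree n f" "n \<ge> 1"
  shows "finite (f -` {w})" "f -` {w} \<noteq> {}"
proof -
  obtain p q where pq: "coprime p q" "max (degree p) (degree q) = n" "f = rat_map p q"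
    using assms(1) unfolding rational_of_degree_def by blast
  obtain u v where uv: "u \<noteq> 0 \<or> v \<noteq> 0" "w = pt u v" by (rule pt_cases)
  note cf = card_fibre[OF pq(1,2) assms(2) uv(1)]
  show "finite (f -` {w})" using cf(1) pq uv by simp
  have "card (f -` {w}) \<noteq> 0"
  proof (cases "degree (smult v p - smult u q) < n")
    case True then show ?thesis using cf(2) pq uv by simp
  next
    case False
    then have "degree (smult v p - smult u q) \<noteq> 0" using assms(2) by simp
    then obtain z where "poly (smult v p - smult u q) z = 0"
      using fundamental_theorem_of_algebra by (metis constant_degree)
    then have "card {z. poly (smult v p - smult u q) z = 0} \<noteq> 0"
      using poly_roots_finite[OF cf(4)] by (auto simp: card_eq_0_iff)
    then show ?thesis using cf(2) pq uv by simp
  qed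
  then show "f -` {w} \<noteq> {}" by auto
qed

lemma rational_surj: "rational_of_degree n f \<Longrightarrow> n \<ge> 1 \<Longrightarrow> surj f"
  using fibre_finite_nonempty(2)[of n f] by (intro surjI[of f "\<lambda>w. SOME x. x \<in> f -` {w}"])
    (metis all_not_in_conv someI_ex vimage_singleton_eq)

text \<open>The critical values of a map of degree \<open>n\<close>, described by counting preimages
  so that coordinate changes on either side are easily followed.\<close>

definition small_fibre :: "nat \<Rightarrow> (cp1 \<Rightarrow> cp1) \<Rightarrow> cp1 set" where
  "small_fibre n f = {w. card (f -` {w}) < n}"

section \<open>Critical points through the Wronskian, the numerator of the derivative of
  \<open>p / q\<close>\<close>

definition wronskian :: "complex poly \<Rightarrow> complex poly \<Rightarrow> complex poly" where
  "wronskian p q = pderiv p * q - p * pderiv q"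

text \<open>At a root of a nonconstant \<open>p\<close>, where \<open>q\<close> does not vanish,
  \<open>pderiv p * q\<close> has order one less than \<open>p\<close>, while
  \<open>p * pderiv q\<close> has at least the order of \<open>p\<close>. If \<open>q\<close> is
  nonconstant, the roles are exchanged.\<close>

lemma wronskian_nonzero:
  assumes "coprime p q" "max (degree p) (degree q) \<ge> 1"
  shows "wronskian p q \<noteq> 0"
proof
  have *: False
    if "coprime p q" "degree p \<ge> 1" "pderiv p * q = p * pderiv q" for p q :: "complex poly"
  proof -
    obtain z where z: "poly p z = 0"
      using fundamental_theorem_of_algebra[of p] \<open>degree p \<ge> 1\<close> by (auto simp: constant_degree)
    then have qz: "poly q z \<noteq> 0" using coprime_poly_0[OF that(1), of z] by simp
    have nz: "p \<noteq> 0" "pderiv p \<noteq> 0" "q \<noteq> 0"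
      using that(2) qz by (auto simp: pderiv_eq_0_iff)
    have "order z (pderiv p * q) = order z (pderiv p)"
      using nz qz by (simp add: order_mult order_0I)
    moreover have "order z (p * pderiv q) = order z p + order z (pderiv q)"
      using nz that(3) by (intro order_mult) (metis mult_eq_0_iff)
    moreover have "order z p = Suc (order z (pderiv p))"
      using nz z by (intro order_pderiv) (auto simp: order_root)
    ultimately show False using that(3) by simp
  qed
  assume "wronskian p q = 0"
  then have eq: "pderiv p * q = p * pderiv q" by (simp add: wronskian_def)
  consider "degree p \<ge> 1" | "degree q \<ge> 1" using assms(2) by linarith
  then show False
  proof cases
    case 1 then show False using * assms(1) eq by blast
  next
    case 2 then show False
      using *[of q p] assms(1) eq by (simp add: coprime_commute mult.commute)
  qed
qed

text \<open>A multiple root \<open>z\<close> of \<open>v p - u q\<close> makes \<open>(v, - u)\<close> a nontrivial kernel vector of the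
  Wronskian matrix of \<open>p\<close> and \<open>q\<close> at \<open>z\<close>.\<close>

lemma finite_small_fibre:
  assumes "rational_of_degree n f" "n \<ge> 1"
  shows "finite (small_fibre n f)"
proof -
  obtain p q where pq: "coprime p q" "max (degree p) (degree q) = n" "f = rat_map p q"
    using assms(1) unfolding rational_of_degree_def by blast
  have "small_fibre n f \<subseteq> insert (f Infty) (f ` Fin ` {z. poly (wronskian p q) z = 0})"
  proof
    fix w assume w: "w \<in> small_fibre n f"
    obtain u v where uv: "u \<noteq> 0 \<or> v \<noteq> 0" "w = pt u v" by (rule pt_cases)
    define P where "P = smult v p - smult u q"
    note cf = card_fibre[OF pq(1,2) assms(2) uv(1), folded P_def]
    show "w \<in> insert (f Infty) (f ` Fin ` {z. poly (wronskian p q) z = 0})"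
    \<comment> \<open>A drop in degree puts infinity into the fibre, so it accounts only for the
      value \<open>f Infty\<close>. Otherwise a small fibre comes from a multiple root.\<close>
    proof (cases "degree P < n")
      case True
      then have "coeff P n = 0" by (rule coeff_eq_0)
      then have "Infty \<in> f -` {w}"
        using fibre_eq[OF pq(1,2) uv(1), folded P_def] by (simp add: pq(3) uv(2))
      then show ?thesis by auto
    next
      case False
      then have "card {x. poly P x = 0} < degree P"
        using w cf(2,3) by (simp add: small_fibre_def pq(3) uv(2))
      then obtain z where z: "poly P z = 0" "poly (pderiv P) z = 0"
        using card_roots_eq_degree[OF cf(4)] by force
      have "f (Fin z) = w"
        using fibre_eq[OF pq(1,2) uv(1), folded P_def] z(1) pq(3) uv(2) by blast
      moreover have "poly (wronskian p q) z = 0"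
      proof -
        have 1: "v * poly p z = u * poly q z" "v * poly (pderiv p) z = u * poly (pderiv q) z"
          using z by (simp_all add: P_def pderiv_diff pderiv_smult)
        have "v * poly (wronskian p q) z =
            (v * poly (pderiv p) z) * poly q z - (v * poly p z) * poly (pderiv q) z"
          by (simp add: wronskian_def algebra_simps)
        also have "\<dots> = 0" unfolding 1 by simp
        finally have "v * poly (wronskian p q) z = 0" .
        moreover have "u * poly (wronskian p q) z =
            (u * poly q z) * poly (pderiv p) z - (u * poly (pderiv q) z) * poly p z"
          by (simp add: wronskian_def algebra_simps)
        moreover have "\<dots> = 0" unfolding 1[symmetric] by simp
        ultimately have "u * poly (wronskian p q) z = 0" "v * poly (wronskian p q) z = 0" by simp_all
        then show ?thesis using uv(1) by auto
      qed
      ultimately show ?thesis by auto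
    qed
  qed
  moreover have "finite {z. poly (wronskian p q) z = 0}"
    using pq assms(2) by (intro poly_roots_finite wronskian_nonzero) auto
  ultimately show ?thesis by (meson finite.insertI finite_imageI finite_subset)
qed

text \<open>Over the value at \<open>z\<close> the polynomial \<open>P\<close> vanishes at
  \<open>z\<close>, and its derivative there is the Wronskian, so \<open>z\<close> is a multiple
  root.\<close>

lemma wronskian_root_small_fibre:
  assumes "coprime p q" "max (degree p) (degree q) = n" "n \<ge> 1" "poly (wronskian p q) z = 0"
  shows "rat_map p q (Fin z) \<in> small_fibre n (rat_map p q)"
proof -
  define u v where "u = poly p z" and "v = poly q z"
  have uv: "u \<noteq> 0 \<or> v \<noteq> 0" unfolding u_def v_def by (rule coprime_poly_0[OF assms(1)])
  define P where "P = smult v p - smult u q"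
  note cf = card_fibre[OF assms(1-3) uv, folded P_def]
  have "poly P z = 0" "poly (pderiv P) z = 0"
    using assms(4) by (simp_all add: P_def u_def v_def wronskian_def pderiv_diff pderiv_smult algebra_simps)
  then have "card {x. poly P x = 0} < degree P" by (intro card_roots_lt_degree cf)
  then have "card (rat_map p q -` {pt u v}) < n" using cf(2,3) by simp
  then show ?thesis by (simp add: small_fibre_def rat_map_Fin u_def v_def)
qed

text \<open>With \<open>\<theta> = z d/dz\<close> and \<open>a\<close> the order of \<open>p\<close> at \<open>0\<close>, the polynomial \<open>z\<close> times the Wronskian
  equals \<open>\<theta> p \<cdot> q - p \<cdot> \<theta> q\<close>. It has order \<open>a\<close> at \<open>0\<close> and no other root, hence degree \<open>a\<close>; but its
  degree is also \<open>degree p + degree q\<close>, and \<open>a \<le> degree p\<close>.\<close>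

lemma wronskian_monomial:
  fixes p q :: "complex poly"
  assumes "p \<noteq> 0" "q \<noteq> 0" "degree p \<noteq> degree q" "poly p 0 = 0" "poly q 0 \<noteq> 0"
    and root: "\<And>z. poly (wronskian p q) z = 0 \<Longrightarrow> z = 0"
  shows "degree q = 0" "p = monom (lead_coeff p) (degree p)"
proof -
  define \<theta> :: "complex poly \<Rightarrow> complex poly" where "\<theta> r = pCons 0 (pderiv r)" for r
  have coeff_\<theta>: "coeff (\<theta> r) i = of_nat i * coeff r i" for r i
    by (cases i) (auto simp: \<theta>_def coeff_pderiv)
  have deg_\<theta>: "degree (\<theta> r) \<le> degree r" for r
    by (rule degree_le) (auto simp: coeff_\<theta> coeff_eq_0)
  define a where "a = order 0 p"
  obtain p1 where p1: "p = [:0, 1:] ^ a * p1" "\<not> [:0, 1:] dvd p1"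
    using order_decomp[OF assms(1), of 0] by (auto simp: a_def)
  have X: "[:0, 1:] ^ a = monom (1::complex) a" by (simp add: monom_altdef)
  have p1_0: "poly p1 0 \<noteq> 0" "p1 \<noteq> 0"
    using p1(2) poly_eq_0_iff_dvd[of p1 0] by auto
  have "a \<noteq> 0" using assms(1,4) by (simp add: a_def order_root)
  have p: "p = monom 1 a * p1" using p1(1) X by simp
  have deg_p: "degree p = a + degree p1"
    unfolding p using p1_0(2) by (simp add: degree_mult_eq degree_monom_eq)
  \<comment> \<open>The cofactor of \<open>z ^ a\<close> in \<open>z\<close> times the Wronskian;
    its value at \<open>0\<close> is \<open>a\<close> times the nonzero values of \<open>p1\<close>
    and \<open>q\<close> there.\<close>
  define V where "V = smult (of_nat a) (p1 * q) + \<theta> p1 * q - p1 * \<theta> q"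
  have \<theta>p: "\<theta> p = monom 1 a * (smult (of_nat a) p1 + \<theta> p1)"
    by (rule poly_eqI) (auto simp: coeff_\<theta> p coeff_monom_mult distrib_right left_diff_distrib of_nat_diff)
  have WV: "pCons 0 (wronskian p q) = monom 1 a * V"
  proof -
    have "pCons 0 (wronskian p q) = \<theta> p * q - p * \<theta> q"
      by (simp add: \<theta>_def wronskian_def)
    then show ?thesis
      unfolding \<theta>p by (simp add: V_def p algebra_simps)
  qed
  have V0: "poly V 0 \<noteq> 0"
    using p1_0(1) assms(5) \<open>a \<noteq> 0\<close> by (simp add: V_def \<theta>_def)
  have "poly V z \<noteq> 0" for z
  proof
    assume z: "poly V z = 0"
    then have "z \<noteq> 0" using V0 by auto
    moreover have "z * poly (wronskian p q) z = 0"
      using arg_cong[OF WV, of "\<lambda>r. poly r z"] z by simp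
    ultimately show False using root[of z] by simp
  qed
  then have "degree V = 0"
    using fundamental_theorem_of_algebra[of V] by (auto simp: constant_degree)
  moreover have "V \<noteq> 0" using V0 by auto
  ultimately have "degree (pCons 0 (wronskian p q)) = a"
    unfolding WV by (simp add: degree_mult_eq degree_monom_eq)
  \<comment> \<open>The top coefficient is \<open>degree p - degree q\<close> times both leading
    coefficients, hence nonzero as the degrees differ.\<close>
  moreover have "coeff (pCons 0 (wronskian p q)) (degree p + degree q) \<noteq> 0"
  proof -
    have "coeff (\<theta> p * q - p * \<theta> q) (degree p + degree q)
        = (of_nat (degree p) - of_nat (degree q)) * (lead_coeff p * lead_coeff q)"
      by (simp only: coeff_diff coeff_mult_at_bound[OF deg_\<theta> order_refl]
          coeff_mult_at_bound[OF order_refl deg_\<theta>] coeff_\<theta>) (simp add: algebra_simps)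
    then show ?thesis
      using assms(1-3) by (simp add: \<theta>_def wronskian_def)
  qed
  ultimately have "degree p + degree q \<le> a" using le_degree by blast
  then have "degree q = 0" "degree p1 = 0" using deg_p by auto
  then show "degree q = 0" by simp
  obtain c where c: "p1 = [:c:]" using \<open>degree p1 = 0\<close> by (rule degree_eq_zeroE)
  then have "p = monom c a" unfolding p by (simp add: smult_monom)
  then show "p = monom (lead_coeff p) (degree p)"
    using assms(1) by (auto simp: degree_monom_eq)
qed

section \<open>Symmetries of rational maps\<close>

lemma small_fibre_transport:
  assumes "bij \<tau>" "bij \<sigma>"
  shows "\<tau> w \<in> small_fibre n (\<tau> \<circ> f \<circ> \<sigma>) \<longleftrightarrow> w \<in> small_fibre n f"
proof -
  have "(\<tau> \<circ> f \<circ> \<sigma>) -` {\<tau> w} = \<sigma> -` (f -` {w})"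
    using assms(1) by (auto simp: bij_is_inj inj_eq)
  moreover have "card (\<sigma> -` (f -` {w})) = card (f -` {w})"
    using assms(2) by (intro card_vimage_inj) (auto simp: bij_is_inj bij_is_surj)
  ultimately show ?thesis by (simp add: small_fibre_def)
qed

lemma small_fibre_invariant:
  assumes "bij \<sigma>" "bij \<nu>" "f \<circ> \<sigma> = \<nu> \<circ> f"
  shows "\<nu> w \<in> small_fibre n f \<longleftrightarrow> w \<in> small_fibre n f"
proof -
  have "inv_into UNIV \<nu> \<circ> f \<circ> \<sigma> = f"
    using assms(2,3) by (simp add: comp_assoc) (simp add: bij_is_inj flip: comp_assoc)
  then show ?thesis
    using small_fibre_transport[OF bij_imp_bij_inv[OF assms(2)] assms(1), of "\<nu> w" n f] assms(2)
    by (simp add: bij_is_inj)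
qed

text \<open>The preimages include the critical points and control the shape of \<open>f\<close> up
  to a Moebius factor; the values control that factor.\<close>

definition exceptional :: "nat \<Rightarrow> (cp1 \<Rightarrow> cp1) \<Rightarrow> cp1 set" where
  "exceptional n f = small_fibre n f \<union> f -` small_fibre n f"

lemma finite_exceptional:
  assumes "rational_of_degree n f" "n \<ge> 1"
  shows "finite (exceptional n f)"
proof -
  have "f -` small_fibre n f = (\<Union>w\<in>small_fibre n f. f -` {w})" by auto
  then show ?thesis
    using finite_small_fibre[OF assms] fibre_finite_nonempty(1)[OF assms]
    by (simp add: exceptional_def)
qed

section \<open>Maps with at most two exceptional points are conjugate to a power map\<close>

lemma pow_map_Fin: "pow_map n (Fin z) = Fin (z ^ n)"
  by (simp add: pow_map_def rat_map.simps poly_monom)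

lemma pow_map_Infty: "n \<ge> 1 \<Longrightarrow> pow_map n Infty = Infty"
  by (simp add: pow_map_def rat_map.simps degree_monom_eq)

lemma neg_pow_map_Fin: "n \<ge> 1 \<Longrightarrow> neg_pow_map n (Fin z) = (if z = 0 then Infty else Fin (1 / z ^ n))"
  by (simp add: neg_pow_map_def rat_map.simps poly_monom)

lemma neg_pow_map_Infty: "n \<ge> 1 \<Longrightarrow> neg_pow_map n Infty = Fin 0"
  by (simp add: neg_pow_map_def rat_map.simps degree_monom_eq)

text \<open>The condition on \<open>h Infty\<close> excludes equal degrees of \<open>p\<close> and
  \<open>q\<close>, for which this value would be finite and nonzero. The condition
  \<open>crit\<close> confines the roots of the Wronskian to \<open>0\<close>, so
  \<open>wronskian_monomial\<close> applies.\<close>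

lemma normalized_eq_monomial:
  assumes "rational_of_degree n h" "n \<ge> 1"
    and crit: "h -` small_fibre n h \<subseteq> {Fin 0, Infty}"
    and h0: "h (Fin 0) = Fin 0" and hI: "h Infty = Fin 0 \<or> h Infty = Infty"
  shows "\<exists>\<alpha>. moebius \<alpha> \<and> h = \<alpha> \<circ> pow_map n"
proof -
  obtain p q where pq: "coprime p q" "max (degree p) (degree q) = n" "h = rat_map p q"
    using assms(1) unfolding rational_of_degree_def by blast
  have q0: "poly q 0 \<noteq> 0" "poly p 0 = 0"
    using h0 by (auto simp: pq(3) rat_map.simps split: if_splits)
  have "p \<noteq> 0"
  proof
    assume "p = 0"
    then have "is_unit q" "q \<noteq> 0" using pq(1) q0 by auto
    then have "degree q = 0" by (simp add: is_unit_iff_degree)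
    then show False using \<open>p = 0\<close> pq(2) assms(2) by simp
  qed
  have "q \<noteq> 0" using q0 by auto
  have deg_ne: "degree p \<noteq> degree q"
  proof
    assume "degree p = degree q"
    then have "degree p = n" "degree q = n" using pq(2) by auto
    then have "coeff p n \<noteq> 0" "coeff q n \<noteq> 0"
      using \<open>p \<noteq> 0\<close> \<open>q \<noteq> 0\<close> by (metis leading_coeff_neq_0)+
    then show False
      using hI \<open>degree p = n\<close> \<open>degree q = n\<close> by (auto simp: pq(3) rat_map.simps)
  qed
  have "z = 0" if "poly (wronskian p q) z = 0" for z
  proof -
    have "h (Fin z) \<in> small_fibre n h"
      unfolding pq(3) by (rule wronskian_root_small_fibre[OF pq(1,2) assms(2) that])
    then show ?thesis using crit by blast
  qed
  note wm = wronskian_monomial[OF \<open>p \<noteq> 0\<close> \<open>q \<noteq> 0\<close> deg_ne q0(2,1) this]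
  define c where "c = lead_coeff p"
  have p: "p = monom c n" using wm pq(2) by (simp add: c_def)
  obtain e where q: "q = [:e:]" using wm(1) by (rule degree_eq_zeroE)
  have "c \<noteq> 0" "e \<noteq> 0" using p q \<open>p \<noteq> 0\<close> \<open>q \<noteq> 0\<close> by auto
  then have det: "c * e - 0 * 0 \<noteq> 0" by simp
  have "h w = (rat_map [:0, c:] [:e, 0:] \<circ> pow_map n) w" for w
  proof (cases w)
    case (Fin z)
    then show ?thesis
      using \<open>e \<noteq> 0\<close> by (simp add: pow_map_Fin pq(3) p q rat_map.simps poly_monom)
  next
    case Infty
    then show ?thesis
      using \<open>c \<noteq> 0\<close> assms(2)
      by (simp add: pow_map_Infty pq(3) p q rat_map.simps degree_monom_eq coeff_pCons split: nat.split)
  qed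
  then have "h = rat_map [:0, c:] [:e, 0:] \<circ> pow_map n" by auto
  moreover have "moebius (rat_map [:0, c:] [:e, 0:])" unfolding moebius_def using det by blast
  ultimately show ?thesis by blast
qed

lemma two_critical_points:
  assumes "rational_of_degree n f" "n \<ge> 1" "f -` small_fibre n f \<subseteq> {Fin 0, Infty}"
  shows "\<exists>\<alpha>. moebius \<alpha> \<and> f = \<alpha> \<circ> pow_map n"
proof -
  \<comment> \<open>The point to be sent to infinity: \<open>f Infty\<close> if it differs from
    \<open>f (Fin 0)\<close>, and otherwise any other point.\<close>
  define y where "y = (if f Infty = f (Fin 0) then (if f (Fin 0) = Infty then Fin 0 else Infty) else f Infty)"
  have "f (Fin 0) \<noteq> y" by (auto simp: y_def)
  then obtain \<tau> where \<tau>: "moebius \<tau>" "\<tau> (f (Fin 0)) = Fin 0" "\<tau> y = Infty"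
    using moebius_0_Infty by blast
  define h where "h = \<tau> \<circ> f"
  have "rational_of_degree n h" unfolding h_def using \<tau>(1) assms(1) by (rule rational_moebius_comp)
  moreover have "h -` small_fibre n h \<subseteq> {Fin 0, Infty}"
  proof
    fix x assume "x \<in> h -` small_fibre n h"
    then have "f x \<in> small_fibre n f"
      using small_fibre_transport[OF moebius_bij_inv(1)[OF \<tau>(1)] bij_id, of "f x" n f]
      by (simp add: h_def)
    then show "x \<in> {Fin 0, Infty}" using assms(3) by blast
  qed
  moreover have "h (Fin 0) = Fin 0" "h Infty = Fin 0 \<or> h Infty = Infty"
    using \<tau>(2,3) by (auto simp: h_def y_def split: if_splits)
  ultimately obtain \<alpha> where \<alpha>: "moebius \<alpha>" "h = \<alpha> \<circ> pow_map n"
    using normalized_eq_monomial assms(2) by blast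
  have "inv_into UNIV \<tau> \<circ> h = f"
    using moebius_bij_inv(1)[OF \<tau>(1)] by (simp add: h_def bij_is_inj flip: comp_assoc)
  then have "f = (inv_into UNIV \<tau> \<circ> \<alpha>) \<circ> pow_map n" by (simp add: \<alpha>(2) comp_assoc)
  moreover have "moebius (inv_into UNIV \<tau> \<circ> \<alpha>)"
    using moebius_comp moebius_bij_inv(2) \<tau>(1) \<alpha>(1) by blast
  ultimately show ?thesis by blast
qed

lemma complex_root_exists: "n \<ge> 1 \<Longrightarrow> \<exists>z::complex. z ^ n = w"
proof -
  assume "n \<ge> 1"
  have "degree (monom 1 n + [:- w:]) = n"
    using \<open>n \<ge> 1\<close> degree_add_eq_left[of "[:- w:]" "monom 1 n"] by (simp add: degree_monom_eq)
  then obtain z where "poly (monom 1 n + [:- w:]) z = 0"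
    using fundamental_theorem_of_algebra \<open>n \<ge> 1\<close> by (metis constant_degree not_one_le_zero)
  then show ?thesis by (auto simp: poly_monom)
qed

lemma moebius_conjugateI:
  assumes "moebius \<delta>" "f \<circ> \<delta> = \<delta> \<circ> g"
  shows "moebius_conjugate f g"
proof -
  have "f = f \<circ> (\<delta> \<circ> inv_into UNIV \<delta>)"
    using moebius_bij_inv(1)[OF assms(1)] by (metis bij_is_surj comp_id surj_iff)
  also have "\<dots> = \<delta> \<circ> g \<circ> inv_into UNIV \<delta>"
    using assms(2) by (simp flip: comp_assoc)
  finally show ?thesis unfolding moebius_conjugate_def using assms(1) by blast
qed

lemma moebius_conjugate_trans:
  assumes "moebius \<beta>" "f \<circ> \<beta> = \<beta> \<circ> g" "moebius_conjugate g h"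
  shows "moebius_conjugate f h"
proof -
  obtain \<delta> where \<delta>: "moebius \<delta>" "g = \<delta> \<circ> h \<circ> inv_into UNIV \<delta>"
    using assms(3) unfolding moebius_conjugate_def by blast
  then have "g \<circ> \<delta> = \<delta> \<circ> h"
    using moebius_bij_inv(1)[OF \<delta>(1)] by (simp add: comp_assoc bij_is_inj)
  then have "f \<circ> (\<beta> \<circ> \<delta>) = (\<beta> \<circ> \<delta>) \<circ> h"
    using assms(2) by (metis comp_assoc)
  then show ?thesis using moebius_conjugateI moebius_comp assms(1) \<delta>(1) by blast
qed

text \<open>Both \<open>0\<close> and infinity are their own only preimages under the power map, so
  their images under \<open>\<alpha>\<close> have one-point fibres and are critical values. Hence
  \<open>\<alpha>\<close> preserves \<open>{Fin 0, Infty}\<close> and is \<open>k z\<close> or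
  \<open>k / z\<close>; a scaling absorbs \<open>k\<close>.\<close>

lemma conjugate_of_totally_ramified:
  assumes "n \<ge> 2" "moebius \<alpha>" "small_fibre n (\<alpha> \<circ> pow_map n) \<subseteq> {Fin 0, Infty}"
  shows "moebius_conjugate (\<alpha> \<circ> pow_map n) (pow_map n) \<or>
    moebius_conjugate (\<alpha> \<circ> pow_map n) (neg_pow_map n)"
proof -
  define f where "f = \<alpha> \<circ> pow_map n"
  have pow_eq: "pow_map n w = Fin 0 \<longleftrightarrow> w = Fin 0" "pow_map n w = Infty \<longleftrightarrow> w = Infty" for w
    using assms(1) by (cases w; simp add: pow_map_Fin pow_map_Infty)+
  have in_small: "\<alpha> w \<in> {Fin 0, Infty}" if "w \<in> {Fin 0, Infty}" for w
  proof -
    have "f -` {\<alpha> w} = {w}"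
      using that moebius_bij_inv(1)[OF assms(2)] pow_eq by (auto simp: f_def bij_is_inj inj_eq)
    then have "\<alpha> w \<in> small_fibre n f" using assms(1) by (simp add: small_fibre_def)
    then show ?thesis using assms(3) by (auto simp: f_def)
  qed
  obtain a b c d where det: "a * d - b * c \<noteq> 0" and \<alpha>: "\<alpha> = rat_map [:b, a:] [:d, c:]"
    using assms(2) unfolding moebius_def by blast
  have "\<alpha> (Fin 0) = pt b d" "\<alpha> Infty = pt a c"
    using moebius_pt[OF det, of 0 1] moebius_pt[OF det, of 1 0] by (simp_all add: \<alpha> pt_def)
  then have bd: "b = 0 \<or> d = 0" "a = 0 \<or> c = 0"
    using in_small[of "Fin 0"] in_small[of Infty] by (auto simp: pt_def split: if_splits)
  define \<delta> where "\<delta> l = rat_map [:0, l:] [:1, 0:]" for l :: complex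
  have scale: "moebius (\<delta> l)"
    "\<delta> l (Fin z) = Fin (l * z)" "\<delta> l Infty = Infty"
    if "l \<noteq> 0" for l z
  proof -
    have det: "l * 1 - 0 * 0 \<noteq> 0" using that by simp
    then show "moebius (\<delta> l)" unfolding moebius_def \<delta>_def by blast
    show "\<delta> l (Fin z) = Fin (l * z)"
      using moebius_pt[OF det, of z 1] by (simp add: \<delta>_def pt_def)
    show "\<delta> l Infty = Infty"
      using moebius_pt[OF det, of 1 0] by (simp add: \<delta>_def pt_def)
  qed
  consider "b = 0" "c = 0" "a \<noteq> 0" "d \<noteq> 0" | "a = 0" "d = 0" "b \<noteq> 0" "c \<noteq> 0"
    using bd det by auto
  then show ?thesis
  proof cases
    case 1
    have f: "f (Fin z) = Fin (a / d * z ^ n)" "f Infty = Infty" for z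
      using 1 moebius_pt[OF det, of "z ^ n" 1] moebius_pt[OF det, of 1 0] assms(1)
      by (simp_all add: f_def \<alpha> pow_map_Fin pow_map_Infty pt_def)
    \<comment> \<open>Conjugation by \<open>\<delta> l\<close> requires
      \<open>(a / d) * l ^ n = l\<close>.\<close>
    obtain l where l: "l ^ (n - 1) = d / a"
      using complex_root_exists[of "n - 1" "d / a"] assms(1) by fastforce
    have "l \<noteq> 0" using l 1 assms(1) by (auto simp: power_0_left split: if_splits)
    have "l ^ n = l * (d / a)" using l assms(1) by (metis power_eq_if not_numeral_le_zero)
    then have "(f \<circ> \<delta> l) w = (\<delta> l \<circ> pow_map n) w" for w
      using 1 assms(1) by (cases w)
        (simp_all add: scale[OF \<open>l \<noteq> 0\<close>] f pow_map_Fin pow_map_Infty power_mult_distrib)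
    then have "moebius_conjugate f (pow_map n)"
      by (intro moebius_conjugateI[OF scale(1)[OF \<open>l \<noteq> 0\<close>]]) auto
    then show ?thesis by (simp add: f_def)
  next
    case 2
    have f: "f (Fin z) = (if z = 0 then Infty else Fin (b / c / z ^ n))" "f Infty = Fin 0" for z
      using 2 moebius_pt[OF det, of "z ^ n" 1] moebius_pt[OF det, of 1 0] assms(1)
      by (simp_all add: f_def \<alpha> pow_map_Fin pow_map_Infty pt_def)
    \<comment> \<open>Here conjugation requires \<open>(b / c) / l ^ n = l\<close>.\<close>
    obtain l where l: "l ^ (n + 1) = b / c"
      using complex_root_exists[of "n + 1"] by auto
    have "l \<noteq> 0" using l 2 by auto
    have "b / c = l * l ^ n" using l by simp
    then have "(f \<circ> \<delta> l) w = (\<delta> l \<circ> neg_pow_map n) w" for w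
      using \<open>l \<noteq> 0\<close> assms(1) by (cases w)
        (simp_all add: scale[OF \<open>l \<noteq> 0\<close>] f neg_pow_map_Fin neg_pow_map_Infty power_mult_distrib)
    then have "moebius_conjugate f (neg_pow_map n)"
      by (intro moebius_conjugateI[OF scale(1)[OF \<open>l \<noteq> 0\<close>]]) auto
    then show ?thesis by (simp add: f_def)
  qed
qed

lemma few_exceptional_points:
  assumes "rational_of_degree n f" "n \<ge> 2" "card (exceptional n f) \<le> 2"
  shows "moebius_conjugate f (pow_map n) \<or> moebius_conjugate f (neg_pow_map n)"
proof -
  have fin: "finite (exceptional n f)" using finite_exceptional assms by simp
  have "\<exists>x y. exceptional n f \<subseteq> {x, y} \<and> x \<noteq> y"
  proof -
    \<comment> \<open>Padding to exactly two points lets one Moebius transformation move them to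
      \<open>0\<close> and infinity.\<close>
    obtain B where B: "finite B" "card B = 2 - card (exceptional n f)" "B \<subseteq> UNIV - exceptional n f"
      using infinite_arbitrarily_large[OF Diff_infinite_finite[OF fin infinite_cp1]] by blast
    then have "card (exceptional n f \<union> B) = 2"
      using fin assms(3) by (subst card_Un_disjoint) auto
    then show ?thesis unfolding card_2_iff by blast
  qed
  then obtain x y where xy: "exceptional n f \<subseteq> {x, y}" "x \<noteq> y" by blast
  obtain \<beta> where \<beta>: "moebius \<beta>" "\<beta> x = Fin 0" "\<beta> y = Infty"
    using moebius_0_Infty[OF xy(2)] by blast
  note bij = moebius_bij_inv(1)[OF \<beta>(1)] and inv = moebius_bij_inv(2)[OF \<beta>(1)]
  define h where "h = \<beta> \<circ> f \<circ> inv_into UNIV \<beta>"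
  have h: "rational_of_degree n h"
    unfolding h_def using \<beta>(1) inv assms(1) by (intro rational_comp_moebius rational_moebius_comp)
  have small: "\<beta> w \<in> small_fibre n h \<longleftrightarrow> w \<in> small_fibre n f" for w
    unfolding h_def by (rule small_fibre_transport[OF bij bij_imp_bij_inv[OF bij]])
  have sub: "small_fibre n h \<subseteq> {Fin 0, Infty}" "h -` small_fibre n h \<subseteq> {Fin 0, Infty}"
  proof -
    have "w \<in> {Fin 0, Infty}" if "w \<in> small_fibre n h \<or> h w \<in> small_fibre n h" for w
    proof -
      obtain u where u: "w = \<beta> u" using bij by (metis bij_pointE)
      then have "h w = \<beta> (f u)" using bij by (simp add: h_def bij_is_inj)
      then have "u \<in> exceptional n f"
        using that small u by (auto simp: exceptional_def)
      then show ?thesis using xy(1) u \<beta> by auto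
    qed
    then show "small_fibre n h \<subseteq> {Fin 0, Infty}" "h -` small_fibre n h \<subseteq> {Fin 0, Infty}" by auto
  qed
  obtain \<alpha> where \<alpha>: "moebius \<alpha>" "h = \<alpha> \<circ> pow_map n"
    using two_critical_points[OF h _ sub(2)] assms(2) by auto
  have "moebius_conjugate h (pow_map n) \<or> moebius_conjugate h (neg_pow_map n)"
    using conjugate_of_totally_ramified[OF assms(2) \<alpha>(1)] sub(1) \<alpha>(2) by simp
  moreover have "f \<circ> inv_into UNIV \<beta> = inv_into UNIV \<beta> \<circ> h"
    using bij by (simp add: h_def bij_is_inj flip: comp_assoc)
  ultimately show ?thesis using moebius_conjugate_trans[OF inv] by blast
qed

text \<open>Each \<open>\<phi> \<sigma>\<close> is a symmetry on both sides, so it permutes the small-fibre values as well as their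
  preimages; with three such points there are only finitely many values \<open>\<phi> \<sigma>\<close>. And \<open>\<phi> \<sigma>\<close>
  prescribes \<open>R \<circ> \<sigma>\<close>, which leaves finitely many choices for \<open>\<sigma>\<close> at any three points.\<close>

lemma finite_symmetries:
  assumes R: "rational_of_degree n R" "n \<ge> 2" and card: "card (exceptional n R) \<ge> 3"
    and \<Gamma>: "\<And>\<sigma>. \<sigma> \<in> \<Gamma> \<Longrightarrow> moebius \<sigma>"
    and \<phi>: "\<And>\<sigma>. \<sigma> \<in> \<Gamma> \<Longrightarrow> \<phi> \<sigma> \<in> \<Gamma>" "\<And>\<sigma>. \<sigma> \<in> \<Gamma> \<Longrightarrow> R \<circ> \<sigma> = \<phi> \<sigma> \<circ> R"
  shows "finite \<Gamma>"
proof -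
  define E where "E = exceptional n R"
  define N where "N = {\<nu>. moebius \<nu> \<and> \<nu> ` E \<subseteq> E}"
  define A where "A = {Fin 0, Fin 1, Infty}"
  have "n \<ge> 1" using R(2) by simp
  have "finite N"
    unfolding N_def E_def using card finite_exceptional[OF R(1) \<open>n \<ge> 1\<close>] by (rule finite_moebius_image)
  have inv: "\<phi> \<sigma> w \<in> small_fibre n R \<longleftrightarrow> w \<in> small_fibre n R" if "\<sigma> \<in> \<Gamma>" for \<sigma> w
    using small_fibre_invariant moebius_bij_inv(1) \<Gamma> \<phi> that by blast
  have "\<phi> \<sigma> \<in> N" if \<sigma>: "\<sigma> \<in> \<Gamma>" for \<sigma>
  proof -
    \<comment> \<open>Since \<open>\<phi> \<sigma>\<close> is again in \<open>\<Gamma>\<close>,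
      invariance of the critical values under \<open>\<phi> (\<phi> \<sigma>)\<close> transfers to
      their preimages under \<open>R\<close>.\<close>
    have "R (\<phi> \<sigma> w) = \<phi> (\<phi> \<sigma>) (R w)" for w
      using fun_cong[OF \<phi>(2)[OF \<phi>(1)[OF \<sigma>]]] by simp
    then have "\<phi> \<sigma> w \<in> E" if "w \<in> E" for w
      using that inv[OF \<sigma>] inv[OF \<phi>(1)[OF \<sigma>]] by (auto simp: E_def exceptional_def)
    then show ?thesis using \<Gamma>[OF \<phi>(1)[OF \<sigma>]] by (auto simp: N_def)
  qed
  moreover have "\<sigma> ` A \<subseteq> R -` (\<phi> \<sigma> ` R ` A)" if "\<sigma> \<in> \<Gamma>" for \<sigma>
    using fun_cong[OF \<phi>(2)[OF that]] by auto
  ultimately have "\<Gamma> \<subseteq> (\<Union>\<nu>\<in>N. {\<sigma>. moebius \<sigma> \<and> \<sigma> ` A \<subseteq> R -` (\<nu> ` R ` A)})"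
    using \<Gamma> by blast
  moreover have "finite {\<sigma>. moebius \<sigma> \<and> \<sigma> ` A \<subseteq> R -` (\<nu> ` R ` A)}" for \<nu>
  proof (rule finite_moebius_image)
    show "card A \<ge> 3" by (simp add: A_def)
    have "R -` (\<nu> ` R ` A) = (\<Union>w\<in>\<nu> ` R ` A. R -` {w})" by auto
    then show "finite (R -` (\<nu> ` R ` A))"
      using fibre_finite_nonempty(1)[OF R(1) \<open>n \<ge> 1\<close>] by (simp add: A_def)
  qed
  ultimately show ?thesis using \<open>finite N\<close> by (meson finite_UN finite_subset)
qed

text \<open>All but finitely many values have at least \<open>n\<close> preimages.\<close>

lemma rational_not_inj:
  assumes "rational_of_degree n f" "n \<ge> 2"
  shows "\<not> inj f"
proof
  assume inj: "inj f"
  have "finite (small_fibre n f)" using finite_small_fibre assms by simp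
  then obtain w where "w \<notin> small_fibre n f" using infinite_cp1 by (metis UNIV_I finite_subset subsetI)
  then have "card (f -` {w}) \<ge> 2" using assms(2) by (simp add: small_fibre_def)
  moreover have "card (f -` {w}) \<le> card {w}"
    using inj by (intro card_inj_on_le[of f]) (auto intro: inj_on_subset)
  ultimately show False by simp
qed

section \<open>The symmetry group of a rational map acting on the semigroup\<close>

lemma group_G_group: "Group.group (G_group R)"
proof (rule groupI)
  fix \<sigma> \<tau> assume "\<sigma> \<in> carrier (G_group R)" "\<tau> \<in> carrier (G_group R)"
  then obtain \<nu> \<kappa> where *: "moebius \<sigma>" "moebius \<tau>" "moebius \<nu>" "moebius \<kappa>"
    "R \<circ> \<sigma> = \<nu> \<circ> R" "R \<circ> \<tau> = \<kappa> \<circ> R" by (auto simp: G_group_def)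
  then have "R \<circ> (\<sigma> \<circ> \<tau>) = (\<nu> \<circ> \<kappa>) \<circ> R" by (metis comp_assoc)
  with * show "\<sigma> \<otimes>\<^bsub>G_group R\<^esub> \<tau> \<in> carrier (G_group R)"
    by (auto simp: G_group_def intro!: moebius_comp exI[of _ "\<nu> \<circ> \<kappa>"])
next
  show "\<one>\<^bsub>G_group R\<^esub> \<in> carrier (G_group R)"
    by (auto simp: G_group_def moebius_id intro!: exI[of _ id])
next
  fix \<sigma> assume "\<sigma> \<in> carrier (G_group R)"
  then obtain \<nu> where *: "moebius \<sigma>" "moebius \<nu>" "R \<circ> \<sigma> = \<nu> \<circ> R" by (auto simp: G_group_def)
  note bij = moebius_bij_inv(1)[OF *(1)] moebius_bij_inv(1)[OF *(2)]
  have "R \<circ> inv_into UNIV \<sigma> = inv_into UNIV \<nu> \<circ> (\<nu> \<circ> R) \<circ> inv_into UNIV \<sigma>"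
    using bij(2) by (simp add: bij_is_inj flip: comp_assoc)
  also have "\<dots> = inv_into UNIV \<nu> \<circ> R \<circ> (\<sigma> \<circ> inv_into UNIV \<sigma>)"
    by (simp only: *(3)[symmetric] comp_assoc)
  also have "\<sigma> \<circ> inv_into UNIV \<sigma> = id" using bij(1) by (simp add: bij_is_surj flip: surj_iff)
  finally have "R \<circ> inv_into UNIV \<sigma> = inv_into UNIV \<nu> \<circ> R" by (simp only: comp_id)
  then have "inv_into UNIV \<sigma> \<in> carrier (G_group R)"
    using moebius_bij_inv(2)[OF *(1)] moebius_bij_inv(2)[OF *(2)] by (auto simp only: G_group_def partial_object.simps mem_Collect_eq)
  moreover have "inv_into UNIV \<sigma> \<circ> \<sigma> = id" using bij(1) by (simp add: bij_is_inj)
  ultimately show "\<exists>\<tau>\<in>carrier (G_group R). \<tau> \<otimes>\<^bsub>G_group R\<^esub> \<sigma> = \<one>\<^bsub>G_group R\<^esub>"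
    by (auto simp: G_group_def)
qed (auto simp: G_group_def comp_assoc)

text \<open>Surjectivity of \<open>R\<close> makes \<open>\<nu>\<close> unique, so the definite
  description in \<open>gamma\<close> is meaningful.\<close>

lemma gamma_props:
  assumes "surj R" "\<sigma> \<in> carrier (G_group R)"
  shows "moebius (gamma R \<sigma>)" "R \<circ> \<sigma> = gamma R \<sigma> \<circ> R"
proof -
  have "\<exists>!\<nu>. moebius \<nu> \<and> R \<circ> \<sigma> = \<nu> \<circ> R"
    using assms by (auto simp: G_group_def) (metis surj_fun_eq)
  then have "moebius (gamma R \<sigma>) \<and> R \<circ> \<sigma> = gamma R \<sigma> \<circ> R"
    unfolding gamma_def by (rule theI')
  then show "moebius (gamma R \<sigma>)" "R \<circ> \<sigma> = gamma R \<sigma> \<circ> R" by auto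
qed

lemma nonconst_rational_comp:
  "nonconst_rational f \<Longrightarrow> nonconst_rational g \<Longrightarrow> nonconst_rational (f \<circ> g)"
  unfolding nonconst_rational_def using rational_comp by (metis mult_le_mono nat_mult_1)

theorem theorem4p3:
  fixes R :: "cp1 \<Rightarrow> cp1" and \<Gamma> :: "(cp1 \<Rightarrow> cp1) set" and n :: nat
  assumes "rational_of_degree n R" and "n \<ge> 2"
    and "\<not> moebius_conjugate R (pow_map n)"
    and "\<not> moebius_conjugate R (neg_pow_map n)"
    and "subgroup \<Gamma> (G_group R)"
    and "gamma R ` \<Gamma> \<subseteq> \<Gamma>"
  shows "(left_amenable (\<circ>) (S_semigroup \<Gamma> R) \<longleftrightarrow> gamma R ` \<Gamma> = \<Gamma>) \<and>
         (gamma R ` \<Gamma> = \<Gamma> \<longrightarrow>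
            S_semigroup \<Gamma> R \<subseteq> C_inf R \<and>
            (\<forall>T. subsemigroup (\<circ>) T (S_semigroup \<Gamma> R) \<longrightarrow> amenable (\<circ>) T))"
proof -
  have "surj R" using rational_surj assms(1,2) by simp
  have carrier: "\<sigma> \<in> carrier (G_group R)" if "\<sigma> \<in> \<Gamma>" for \<sigma>
    using subgroup.subset[OF assms(5)] that by blast
  have moeb: "moebius \<sigma>" if "\<sigma> \<in> \<Gamma>" for \<sigma>
    using carrier[OF that] by (simp add: G_group_def)
  interpret skew_semigroup R \<Gamma> "gamma R"
  proof
    show "surj R" by fact
    show "\<not> inj R" by (rule rational_not_inj[OF assms(1,2)])
    show "id \<in> \<Gamma>" using subgroup.one_closed[OF assms(5)] by (simp add: G_group_def)
    fix \<sigma> assume \<sigma>: "\<sigma> \<in> \<Gamma>"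
    show "\<sigma> \<circ> \<tau> \<in> \<Gamma>" if "\<tau> \<in> \<Gamma>" for \<tau>
      using subgroup.m_closed[OF assms(5) \<sigma> that] by (simp add: G_group_def)
    show bij: "bij \<sigma>" using moebius_bij_inv(1) moeb \<sigma> by blast
    show "gamma R \<sigma> \<in> \<Gamma>" using assms(6) \<sigma> by blast
    show "R \<circ> \<sigma> = gamma R \<sigma> \<circ> R" using gamma_props(2) \<open>surj R\<close> carrier \<sigma> by blast
    \<comment> \<open>The abstract group inverse is a left inverse of the bijection
      \<open>\<sigma>\<close>, hence equal to \<open>inv_into UNIV \<sigma>\<close>.\<close>
    define \<tau> where "\<tau> = m_inv (G_group R) \<sigma>"
    have "\<tau> \<in> \<Gamma>" unfolding \<tau>_def by (rule subgroup.m_inv_closed[OF assms(5) \<sigma>])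
    moreover have "\<tau> \<circ> \<sigma> = id"
      using group.l_inv[OF group_G_group carrier[OF \<sigma>]] by (simp add: \<tau>_def G_group_def)
    ultimately show "inv_into UNIV \<sigma> \<in> \<Gamma>"
      using bij by (metis bij_is_surj comp_assoc comp_id id_comp surj_iff)
  qed
  have "card (exceptional n R) \<ge> 3"
    using few_exceptional_points[OF assms(1,2)] assms(3,4) by linarith
  then have "finite \<Gamma>"
    using finite_symmetries[OF assms(1,2) _ moeb phi_mem R_comp] by blast
  have onto: "S \<subseteq> C_inf R" "\<And>T. subsemigroup (\<circ>) T S \<Longrightarrow> amenable (\<circ>) T"
    if "gamma R ` \<Gamma> = \<Gamma>"
  proof -
    obtain m where m: "m \<ge> 1" "\<And>s. s \<in> S \<Longrightarrow> s \<circ> R ^^ m = R ^^ m \<circ> s"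
      using central_iterate[OF \<open>finite \<Gamma>\<close> \<open>gamma R ` \<Gamma> = \<Gamma>\<close>] by blast
    have "nonconst_rational s" if "s \<in> S" for s
      using that
    proof induction
      case (gen f)
      then have "rational_of_degree 1 f \<or> f = R" using moeb by (auto simp: moebius_iff_degree_1)
      then show ?case using assms(1,2) unfolding nonconst_rational_def
        by (metis Suc_1 Suc_leD le_refl One_nat_def)
    qed (rule nonconst_rational_comp)
    then show "S \<subseteq> C_inf R" using m by (auto simp: C_inf_def C_comm_def)
    show "amenable (\<circ>) T" if "subsemigroup (\<circ>) T S" for T
      using subsemigroup_amenable[OF \<open>finite \<Gamma>\<close> \<open>gamma R ` \<Gamma> = \<Gamma>\<close> that] .
  qed
  have "subsemigroup (\<circ>) S S"
    using mem_S[OF id_mem] by (auto simp: subsemigroup_def intro: comp_semigroup.comp)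
  \<comment> \<open>Taking \<open>S\<close> as its own subsemigroup gives left amenability from
    surjectivity of \<open>gamma R\<close> on \<open>\<Gamma>\<close>.\<close>
  then have "left_amenable (\<circ>) S \<longleftrightarrow> gamma R ` \<Gamma> = \<Gamma>"
    using onto(2) phi_onto_if_left_amenable by (auto simp: amenable_def)
  then show ?thesis
    unfolding S_semigroup_def using onto by blast
qed

end
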